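(* There exists a conformal mapping $f$ on $\mathbb H$ satisfying both (i) the image $f(\mathbb H)$ is a Jordan domain, but not a quasidisk; and (ii) $\displaystyle\lim_{\mathrm{Re}\,z\to0^+}(2\,\mathrm{Re}\,z)^2\,|Sf(z)|=0$.
   Context: $\mathbb H=\{z=x+iy\in\mathbb C:x>0\}$ is the right half-plane. A conformal mapping on $\mathbb H$ is a univalent analytic function on $\mathbb H$. $Sf:=(Pf)'-(Pf)^2/2$ with $Pf:=f''/f'$ is the Schwarzian derivative. The limit is uniform in $\mathrm{Im}\,z$: $\sup_{0<\mathrm{Re}\,z\le t}(2\,\mathrm{Re}\,z)^2|Sf(z)|\to0$ as $t\to0^+$. A Jordan domain is a domain in the extended plane $\overline{\mathbb C}$ bounded by a Jordan curve of $\overline{\mathbb C}$ (which may pass through $\infty$); a quasidisk is the image of a disk or half-plane under a quasiconformal homeomorphism of $\overline{\mathbb C}$. *)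

theory Defs
  imports "HOL-Analysis.Analysis"
begin

definition right_half_plane :: "complex set"
  where "right_half_plane = {z. 0 < Re z}"

definition conformal_mapping_on :: "complex set \<Rightarrow> (complex \<Rightarrow> complex) \<Rightarrow> bool"
  where "conformal_mapping_on S f \<longleftrightarrow> f holomorphic_on S \<and> inj_on f S"

definition pre_schwarzian :: "(complex \<Rightarrow> complex) \<Rightarrow> complex \<Rightarrow> complex"
  where "pre_schwarzian f z = deriv (deriv f) z / deriv f z"

definition schwarzian :: "(complex \<Rightarrow> complex) \<Rightarrow> complex \<Rightarrow> complex"
  where "schwarzian f z = deriv (pre_schwarzian f) z - (pre_schwarzian f z)\<^sup>2 / 2"

text \<open>The extended plane is the one-point compactification of the plane: \<^term>\<open>None\<close> is the
  point at infinity, and a subset \<^term>\<open>A\<close> of the plane becomes \<^term>\<open>Some ` A\<close>.\<close>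

definition extended_plane :: "complex option topology"
  where "extended_plane = Alexandroff_compactification euclidean"

definition jordan_curve :: "complex option set \<Rightarrow> bool"
  where "jordan_curve J \<longleftrightarrow>
    (\<exists>g. continuous_map (top_of_set (sphere (0::complex) 1)) extended_plane g \<and>
         inj_on g (sphere 0 1) \<and> J = g ` sphere 0 1)"

definition jordan_domain :: "complex option set \<Rightarrow> bool"
  where "jordan_domain D \<longleftrightarrow>
    D \<noteq> {} \<and> openin extended_plane D \<and> connectedin extended_plane D \<and>
    jordan_curve (extended_plane frontier_of D)"

definition curve_length :: "(real \<Rightarrow> complex) \<Rightarrow> real \<Rightarrow> real \<Rightarrow> ennreal"
  where "curve_length \<gamma> a b =
    Sup {(\<Sum>i<n. ennreal (dist (\<gamma> (t i)) (\<gamma> (t (Suc i))))) | (n::nat) (t::nat \<Rightarrow> real).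
          mono t \<and> range t \<subseteq> {a..b}}"

text \<open>Parametrization by arc length of a rectifiable curve on \<open>[0, 1]\<close>. A parameter with prescribed
  length exists for continuous rectifiable curves; it need not be unique, but the curve is constant
  on the set of all of them, so the choice is immaterial.\<close>

definition arc_length_param :: "(real \<Rightarrow> complex) \<Rightarrow> real \<Rightarrow> complex"
  where "arc_length_param \<gamma> u = \<gamma> (SOME t. t \<in> {0..1} \<and> curve_length \<gamma> 0 t = ennreal u)"

definition line_integral :: "(complex \<Rightarrow> ennreal) \<Rightarrow> (real \<Rightarrow> complex) \<Rightarrow> ennreal"
  where "line_integral \<rho> \<gamma> =
    (\<integral>\<^sup>+u\<in>{0..enn2real (curve_length \<gamma> 0 1)}. \<rho> (arc_length_param \<gamma> u) \<partial>lborel)"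

text \<open>Conformal modulus of a family of curves in the extended plane. As usual, only rectifiable
  curves in the finite plane impose a condition on the density.\<close>

definition admissible_density :: "(real \<Rightarrow> complex option) set \<Rightarrow> (complex \<Rightarrow> ennreal) \<Rightarrow> bool"
  where "admissible_density \<Gamma> \<rho> \<longleftrightarrow>
    \<rho> \<in> borel_measurable borel \<and>
    (\<forall>\<gamma>\<in>\<Gamma>. None \<notin> \<gamma> ` {0..1} \<longrightarrow> curve_length (the \<circ> \<gamma>) 0 1 < \<infinity> \<longrightarrow>
       1 \<le> line_integral \<rho> (the \<circ> \<gamma>))"

definition curve_modulus :: "(real \<Rightarrow> complex option) set \<Rightarrow> ennreal"
  where "curve_modulus \<Gamma> = (INF \<rho>\<in>{\<rho>. admissible_density \<Gamma> \<rho>}. \<integral>\<^sup>+z. (\<rho> z)\<^sup>2 \<partial>lborel)"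

text \<open>Geometric definition of quasiconformality: moduli of curve families are quasi-invariant.
  Constant curves are left out: a finite constant curve forces infinite modulus whereas the constant
  curve at infinity imposes no condition, so with them even Moebius maps moving infinity would
  be excluded. Sense-reversing maps are allowed; this does not affect the notion of quasidisk, since
  every disk or half-plane is invariant under some reflection in a line.\<close>

definition nonconstant_curve :: "(real \<Rightarrow> complex option) \<Rightarrow> bool"
  where "nonconstant_curve \<gamma> \<longleftrightarrow>
    pathin extended_plane \<gamma> \<and> (\<exists>s\<in>{0..1}. \<exists>t\<in>{0..1}. \<gamma> s \<noteq> \<gamma> t)"

definition quasiconformal :: "(complex option \<Rightarrow> complex option) \<Rightarrow> bool"
  where "quasiconformal h \<longleftrightarrow>
    homeomorphic_map extended_plane extended_plane h \<and>
    (\<exists>K\<ge>1. \<forall>\<Gamma>. (\<forall>\<gamma>\<in>\<Gamma>. nonconstant_curve \<gamma>) \<longrightarrow>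
       curve_modulus ((\<lambda>\<gamma>. h \<circ> \<gamma>) ` \<Gamma>) \<le> ennreal K * curve_modulus \<Gamma> \<and>
       curve_modulus \<Gamma> \<le> ennreal K * curve_modulus ((\<lambda>\<gamma>. h \<circ> \<gamma>) ` \<Gamma>))"

definition disk_or_half_plane :: "complex set \<Rightarrow> bool"
  where "disk_or_half_plane U \<longleftrightarrow>
    (\<exists>c r. 0 < r \<and> U = ball c r) \<or> (\<exists>a b. a \<noteq> 0 \<and> U = {z. a \<bullet> z < b})"

definition quasidisk :: "complex option set \<Rightarrow> bool"
  where "quasidisk D \<longleftrightarrow>
    (\<exists>h U. quasiconformal h \<and> disk_or_half_plane U \<and> D = h ` Some ` U)"

end

(*
The map f(z) = Ln (1 + z) sends the half-plane onto the domain D of all w with |Im w| < pi/2 and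
1 < Re (exp w), a half-strip whose boundary curve closes up in a cusp at infinity, and its Schwarzian
derivative 1 / (2 (1 + z)^2) is bounded.

D is not a quasidisk. The vertical crosscuts of D over the abscissae in [M, 2M] have modulus at least
M / pi. If h is quasiconformal and D = h(U) for a disk or half-plane U, pull the crosscuts back to U,
reflect them in the boundary of U (a map that is bilipschitz on a neighbourhood of that boundary,
which is where the preimages lie for large M), and apply h again. The resulting curves lie outside D
and join a point above the positive real axis to a point below it, so they cross the negative real
axis and have length at least M; the density 1 / M on a disk of radius 4M shows that their modulus is
bounded independently of M. For large M this contradicts quasi-invariance of the modulus.
*)
theory Submission
  imports Defs
begin

section \<open>Curve length\<close>

text \<open>Condition (ii) sees f only on the strips Re z \<le> t. Infinity approached with large Re
  z lies beyond its reach, and along the positive real axis (2 Re z)^2 |Sf(z)| tends to 2 for this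
  f. The defect is therefore placed at the boundary point infinity.

  Quasiconformality is given through moduli of curve families, so the contradiction must be one
  between moduli. If the domain were a quasidisk, conjugating the reflection of U by h would give a
  reflection in its boundary curve that distorts moduli boundedly near infinity. At a cusp this
  fails: the inside is so narrow that short crosscuts form a family of large modulus, while outside
  the same end points can only be joined by a long way round.

  The lower bound M / pi grows with M, so any upper bound independent of M suffices, and the
  reflection enters only through a crude bilipschitz estimate. Its price is measure theory: arc
  length and area must both change by bounded factors under Lipschitz maps, and all densities must
  remain Borel.\<close>

lemma sum_le_curve_length:
  "mono t \<Longrightarrow> range t \<subseteq> {a..b} \<Longrightarrow>
    (\<Sum>i<n. ennreal (dist (\<gamma> (t i)) (\<gamma> (t (Suc i))))) \<le> curve_length \<gamma> a b"
  unfolding curve_length_def by (rule Sup_upper) auto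

lemma curve_length_leI:
  assumes "\<And>(n::nat) t. mono t \<Longrightarrow> range t \<subseteq> {a..b} \<Longrightarrow>
    (\<Sum>i<n. ennreal (dist (\<gamma> (t i)) (\<gamma> (t (Suc i))))) \<le> c"
  shows "curve_length \<gamma> a b \<le> c"
  unfolding curve_length_def by (rule Sup_least) (use assms in auto)

lemma dist_le_curve_length:
  assumes "a \<le> s" "s \<le> t" "t \<le> b"
  shows "ennreal (dist (\<gamma> s) (\<gamma> t)) \<le> curve_length \<gamma> a b"
proof -
  let ?t = "\<lambda>i::nat. if i = 0 then s else t"
  have "mono ?t" "range ?t \<subseteq> {a..b}"
    using assms by (auto simp: mono_def)
  from sum_le_curve_length[OF this, of \<gamma> 1] show ?thesis by simp
qed

lemma curve_length_mono:
  assumes "a \<le> c" "d \<le> b"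
  shows "curve_length \<gamma> c d \<le> curve_length \<gamma> a b"
proof (rule curve_length_leI)
  fix n and t :: "nat \<Rightarrow> real"
  assume "mono t" "range t \<subseteq> {c..d}"
  then show "(\<Sum>i<n. ennreal (dist (\<gamma> (t i)) (\<gamma> (t (Suc i))))) \<le> curve_length \<gamma> a b"
    using assms by (intro sum_le_curve_length) fastforce+
qed

text \<open>Clamping the partition points at \<open>s\<close> splits every polygonal sum at \<open>s\<close> without
  refining the partition. This gives additivity of the length, and continuity as well, since the
  number of terms in the part between two close points does not change.\<close>

lemma dist_clamp_le:
  fixes \<gamma> :: "real \<Rightarrow> 'a::metric_space"
  assumes "x \<le> y"
  shows "dist (\<gamma> x) (\<gamma> y)
    \<le> dist (\<gamma> (min x s)) (\<gamma> (min y s)) + dist (\<gamma> (max x s)) (\<gamma> (max y s))"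
  using assms dist_triangle[of "\<gamma> x" "\<gamma> y" "\<gamma> s"] by (auto simp: min_def max_def)

lemma sum_dist_clamp_le:
  fixes \<gamma> :: "real \<Rightarrow> 'a::metric_space" and t :: "nat \<Rightarrow> real"
  assumes "mono t"
  shows "(\<Sum>i<n. ennreal (dist (\<gamma> (t i)) (\<gamma> (t (Suc i)))))
    \<le> (\<Sum>i<n. ennreal (dist (\<gamma> (min (t i) s)) (\<gamma> (min (t (Suc i)) s))))
     + (\<Sum>i<n. ennreal (dist (\<gamma> (max (t i) s)) (\<gamma> (max (t (Suc i)) s))))"
  unfolding sum.distrib[symmetric]
proof (rule sum_mono)
  fix i
  have "t i \<le> t (Suc i)"
    using assms by (simp add: mono_iff_le_Suc)
  from dist_clamp_le[OF this, of \<gamma> s]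
  show "ennreal (dist (\<gamma> (t i)) (\<gamma> (t (Suc i))))
     \<le> ennreal (dist (\<gamma> (min (t i) s)) (\<gamma> (min (t (Suc i)) s)))
      + ennreal (dist (\<gamma> (max (t i) s)) (\<gamma> (max (t (Suc i)) s)))"
    by (metis ennreal_leI ennreal_plus zero_le_dist)
qed

lemma curve_length_split:
  assumes "a \<le> s" "s \<le> b"
  shows "curve_length \<gamma> a b = curve_length \<gamma> a s + curve_length \<gamma> s b"
proof (rule antisym)
  show "curve_length \<gamma> a b \<le> curve_length \<gamma> a s + curve_length \<gamma> s b"
  proof (rule curve_length_leI)
    fix n and t :: "nat \<Rightarrow> real"
    assume t: "mono t" "range t \<subseteq> {a..b}"
    have "mono (\<lambda>i. min (t i) s)" "mono (\<lambda>i. max (t i) s)"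
      using t(1) by (auto simp: mono_def intro: min.coboundedI1 max.coboundedI1)
    moreover have "range (\<lambda>i. min (t i) s) \<subseteq> {a..s}" "range (\<lambda>i. max (t i) s) \<subseteq> {s..b}"
      using t(2) assms by (auto simp: image_subset_iff)
    ultimately have "(\<Sum>i<n. ennreal (dist (\<gamma> (min (t i) s)) (\<gamma> (min (t (Suc i)) s)))) \<le> curve_length \<gamma> a s"
        "(\<Sum>i<n. ennreal (dist (\<gamma> (max (t i) s)) (\<gamma> (max (t (Suc i)) s)))) \<le> curve_length \<gamma> s b"
      using sum_le_curve_length[of "\<lambda>i. min (t i) s" a s \<gamma> n]
        sum_le_curve_length[of "\<lambda>i. max (t i) s" s b \<gamma> n] by auto
    then show "(\<Sum>i<n. ennreal (dist (\<gamma> (t i)) (\<gamma> (t (Suc i)))))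
        \<le> curve_length \<gamma> a s + curve_length \<gamma> s b"
      by (intro order_trans[OF sum_dist_clamp_le[OF t(1), of \<gamma> n s]] add_mono)
  qed
  let ?S = "\<lambda>a b. {(\<Sum>i<n. ennreal (dist (\<gamma> (t i)) (\<gamma> (t (Suc i))))) | (n::nat) (t::nat \<Rightarrow> real).
          mono t \<and> range t \<subseteq> {a..b}}"
  have concat: "x + y \<le> curve_length \<gamma> a b" if "x \<in> ?S a s" "y \<in> ?S s b" for x y
  proof -
    obtain n t where t: "mono t" "range t \<subseteq> {a..s}"
        and x: "x = (\<Sum>i<n. ennreal (dist (\<gamma> (t i)) (\<gamma> (t (Suc i)))))"
      using \<open>x \<in> ?S a s\<close> by auto
    obtain m t' where t': "mono t'" "range t' \<subseteq> {s..b}"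
        and y: "y = (\<Sum>i<m. ennreal (dist (\<gamma> (t' i)) (\<gamma> (t' (Suc i)))))"
      using \<open>y \<in> ?S s b\<close> by auto
    \<comment> \<open>T runs through t 0, ..., t n and then through t' 0, t' 1, .... The two
      partitions need not meet at s, so the term with index n is a gap from t n to t' 0, which is
      dropped; hence the shift by \<open>Suc n\<close>.\<close>
    define T where "T i = (if i \<le> n then t i else t' (i - Suc n))" for i
    have tr: "a \<le> t i" "t i \<le> s" "s \<le> t' i" "t' i \<le> b" for i
      using t(2) t'(2) by (auto simp: image_subset_iff)
    have "mono T"
      unfolding mono_def
    proof (intro allI impI)
      fix i j :: nat assume "i \<le> j"
      then show "T i \<le> T j"
        using t(1) t'(1) order_trans[OF tr(2,3)] by (auto simp: T_def mono_def)
    qed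
    moreover have "range T \<subseteq> {a..b}"
      using tr order_trans[OF tr(2) assms(2)] order_trans[OF assms(1) tr(3)] by (auto simp: T_def)
    ultimately have "(\<Sum>i<Suc n + m. ennreal (dist (\<gamma> (T i)) (\<gamma> (T (Suc i))))) \<le> curve_length \<gamma> a b"
      by (rule sum_le_curve_length)
    moreover have "x + y \<le> (\<Sum>i<Suc n + m. ennreal (dist (\<gamma> (T i)) (\<gamma> (T (Suc i)))))"
    proof -
      let ?f = "\<lambda>i. ennreal (dist (\<gamma> (T i)) (\<gamma> (T (Suc i))))"
      have "x = (\<Sum>i<n. ?f i)"
        unfolding x by (rule sum.cong) (auto simp: T_def)
      moreover have "y = (\<Sum>i\<in>{Suc n..<Suc n + m}. ?f i)"
        unfolding y
        by (rule sum.reindex_bij_witness[of _ "\<lambda>i. i - Suc n" "\<lambda>i. i + Suc n"])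
           (auto simp: T_def Suc_diff_le)
      ultimately have "x + y = (\<Sum>i\<in>{..<n} \<union> {Suc n..<Suc n + m}. ?f i)"
        by (subst sum.union_disjoint) auto
      also have "\<dots> \<le> (\<Sum>i<Suc n + m. ?f i)"
        by (rule sum_mono2) auto
      finally show ?thesis .
    qed
    ultimately show ?thesis by (rule order_trans[rotated])
  qed
  have ne: "?S c d \<noteq> {}" if "c \<le> d" for c d
    using that by (force simp: mono_def intro!: exI[of _ "0::nat"] exI[of _ "\<lambda>_::nat. c"])
  \<comment> \<open>Adding a constant commutes with the supremum of a nonempty set, so
    \<open>concat\<close> passes to the supremum in one variable at a time.\<close>
  have "curve_length \<gamma> a s + y \<le> curve_length \<gamma> a b" if "y \<in> ?S s b" for y
  proof -
    have "curve_length \<gamma> a s + y = (SUP x\<in>?S a s. x + y)"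
      unfolding curve_length_def[of \<gamma> a s]
      by (subst ennreal_SUP_add_left) (use ne[OF assms(1)] in auto)
    also have "\<dots> \<le> curve_length \<gamma> a b"
      by (intro SUP_least concat that)
    finally show ?thesis .
  qed
  then have "(SUP y\<in>?S s b. curve_length \<gamma> a s + y) \<le> curve_length \<gamma> a b"
    by (intro SUP_least)
  then show "curve_length \<gamma> a s + curve_length \<gamma> s b \<le> curve_length \<gamma> a b"
    unfolding curve_length_def[of \<gamma> s b] add.commute[of "curve_length \<gamma> a s"]
    by (subst (asm) ennreal_SUP_add_left) (use ne[OF assms(2)] in auto)
qed

lemma curve_length_lipschitz_le:
  assumes "\<And>x y. x \<in> {a..b} \<Longrightarrow> y \<in> {a..b} \<Longrightarrow> dist (\<delta> x) (\<delta> y) \<le> L * dist (\<gamma> x) (\<gamma> y)"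
  shows "curve_length \<delta> a b \<le> ennreal L * curve_length \<gamma> a b"
proof (rule curve_length_leI)
  fix n and t :: "nat \<Rightarrow> real"
  assume t: "mono t" "range t \<subseteq> {a..b}"
  then have tin: "t i \<in> {a..b}" for i by blast
  have "(\<Sum>i<n. ennreal (dist (\<delta> (t i)) (\<delta> (t (Suc i)))))
      \<le> (\<Sum>i<n. ennreal L * ennreal (dist (\<gamma> (t i)) (\<gamma> (t (Suc i)))))"
    by (rule sum_mono) (use assms[OF tin tin] in \<open>simp add: ennreal_leI flip: ennreal_mult''\<close>)
  also have "\<dots> \<le> ennreal L * curve_length \<gamma> a b"
    unfolding sum_distrib_left[symmetric]
    by (intro mult_left_mono sum_le_curve_length t) auto
  finally show "(\<Sum>i<n. ennreal (dist (\<delta> (t i)) (\<delta> (t (Suc i))))) \<le> ennreal L * curve_length \<gamma> a b" .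
qed

lemma curve_length_refl [simp]: "curve_length \<gamma> a a = 0"
proof -
  have "curve_length \<gamma> a a \<le> 0"
    by (rule curve_length_leI) (simp add: image_subset_iff)
  then show ?thesis by simp
qed

lemma curve_length_approx:
  assumes "curve_length \<gamma> a b < \<infinity>" "e > 0" "a \<le> b"
  obtains n and t :: "nat \<Rightarrow> real" where "mono t" "range t \<subseteq> {a..b}"
    "curve_length \<gamma> a b \<le> (\<Sum>i<n. ennreal (dist (\<gamma> (t i)) (\<gamma> (t (Suc i))))) + ennreal e"
proof (cases "curve_length \<gamma> a b = 0")
  case True
  show ?thesis
    by (rule that[of "\<lambda>_. a" 0]) (use True \<open>a \<le> b\<close> in \<open>auto simp: mono_def\<close>)
next
  case False
  then have "curve_length \<gamma> a b - ennreal e < curve_length \<gamma> a b"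
    using assms by (intro ennreal_between) (auto simp: zero_less_iff_neq_zero)
  then obtain n and t :: "nat \<Rightarrow> real" where "mono t" "range t \<subseteq> {a..b}"
    "curve_length \<gamma> a b - ennreal e < (\<Sum>i<n. ennreal (dist (\<gamma> (t i)) (\<gamma> (t (Suc i)))))"
    unfolding curve_length_def less_Sup_iff by auto
  from this(3) have "curve_length \<gamma> a b
      \<le> (\<Sum>i<n. ennreal (dist (\<gamma> (t i)) (\<gamma> (t (Suc i))))) + ennreal e"
    using ennreal_minus_le_iff add.commute less_imp_le by metis
  with \<open>mono t\<close> \<open>range t \<subseteq> {a..b}\<close> show ?thesis
    by (rule that)
qed

section \<open>Arc length as a parameter\<close>

definition arc_length :: "(real \<Rightarrow> complex) \<Rightarrow> real \<Rightarrow> real"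
  where "arc_length \<gamma> t = enn2real (curve_length \<gamma> 0 t)"

lemma curve_length_finite:
  assumes "curve_length \<gamma> 0 1 < \<infinity>" "0 \<le> s" "t \<le> 1"
  shows "curve_length \<gamma> s t < \<infinity>"
  using curve_length_mono[of 0 s t 1 \<gamma>] assms by (simp add: order.strict_trans1)

text \<open>\<open>enn2real\<close> sends an infinite length to 0, so \<open>arc_length\<close> is
  the true length only once the curve is known to be rectifiable.\<close>

lemma curve_length_eq_arc_length:
  assumes "curve_length \<gamma> 0 1 < \<infinity>" "t \<le> 1"
  shows "curve_length \<gamma> 0 t = ennreal (arc_length \<gamma> t)"
  using curve_length_finite[OF assms(1) order_refl assms(2)] by (simp add: arc_length_def)

lemma arc_length_diff:
  assumes "curve_length \<gamma> 0 1 < \<infinity>" "0 \<le> s" "s \<le> t" "t \<le> 1"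
  shows "curve_length \<gamma> s t = ennreal (arc_length \<gamma> t - arc_length \<gamma> s)" "arc_length \<gamma> s \<le> arc_length \<gamma> t"
proof -
  obtain c where c: "c \<ge> 0" "curve_length \<gamma> s t = ennreal c"
    using curve_length_finite[OF assms(1,2,4)] by (cases "curve_length \<gamma> s t") auto
  have nn: "0 \<le> arc_length \<gamma> s" "0 \<le> arc_length \<gamma> t" by (auto simp: arc_length_def)
  have "ennreal (arc_length \<gamma> t) = ennreal (arc_length \<gamma> s + c)"
    using curve_length_split[OF assms(2,3), of \<gamma>] curve_length_eq_arc_length[OF assms(1)] assms c nn
    by simp
  then have "arc_length \<gamma> t = arc_length \<gamma> s + c"
    using nn c by (subst (asm) ennreal_inj) auto
  then show "curve_length \<gamma> s t = ennreal (arc_length \<gamma> t - arc_length \<gamma> s)" "arc_length \<gamma> s \<le> arc_length \<gamma> t"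
    using c by auto
qed

lemma arc_length_0 [simp]: "arc_length \<gamma> 0 = 0"
  by (simp add: arc_length_def)

lemma arc_length_nonneg [simp]: "0 \<le> arc_length \<gamma> t"
  by (simp add: arc_length_def)

text \<open>A polygon with n steps that misses at most e/2 of the total length is clamped to the
  parts before s, between s and t, and after t. The outer parts are bounded by the lengths there and
  the middle one by n small chords, so the length between s and t is at most e/2 + e/2.\<close>

lemma arc_length_small:
  assumes fin: "curve_length \<gamma> 0 1 < \<infinity>" and cont: "continuous_on {0..1} \<gamma>" and "e > 0"
  obtains d where "d > 0"
    "\<And>s t. 0 \<le> s \<Longrightarrow> s \<le> t \<Longrightarrow> t \<le> 1 \<Longrightarrow> t - s < d \<Longrightarrow> arc_length \<gamma> t - arc_length \<gamma> s \<le> e"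
proof -
  obtain n and P :: "nat \<Rightarrow> real" where P: "mono P" "range P \<subseteq> {0..1}"
    and n: "curve_length \<gamma> 0 1 \<le> (\<Sum>i<n. ennreal (dist (\<gamma> (P i)) (\<gamma> (P (Suc i))))) + ennreal (e/2)"
    using curve_length_approx[OF fin, of "e/2"] \<open>e > 0\<close> by (metis half_gt_zero zero_le_one)
  have "uniformly_continuous_on {0..1} \<gamma>"
    by (intro compact_uniformly_continuous cont) auto
  \<comment> \<open>\<open>Suc n\<close> keeps the denominator nonzero for a polygon without
    steps.\<close>
  moreover have "e / (2 * Suc n) > 0" using \<open>e > 0\<close> by simp
  ultimately obtain d where d: "d > 0"
    "\<And>x y. x \<in> {0..1} \<Longrightarrow> y \<in> {0..1} \<Longrightarrow> dist y x < d \<Longrightarrow> dist (\<gamma> y) (\<gamma> x) < e / (2 * Suc n)"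
    unfolding uniformly_continuous_on_def by metis
  show ?thesis
  proof (rule that[OF \<open>d > 0\<close>])
    fix s t :: real assume st: "0 \<le> s" "s \<le> t" "t \<le> 1" "t - s < d"
    let ?Q = "\<lambda>i. max (P i) s"
    let ?sum = "\<lambda>Q. \<Sum>i<n. ennreal (dist (\<gamma> (Q i)) (\<gamma> (Q (Suc i))))"
    have mono: "mono (\<lambda>i. min (P i) s)" "mono ?Q" "mono (\<lambda>i. max (?Q i) t)"
      using P(1) by (auto simp: mono_def max.coboundedI1 min.coboundedI1)
    have Pin: "0 \<le> P i" "P i \<le> 1" for i using P(2) by (auto simp: image_subset_iff)
    have 1: "?sum (\<lambda>i. min (P i) s) \<le> ennreal (arc_length \<gamma> s)"
      using sum_le_curve_length[OF mono(1), of 0 s \<gamma> n] Pin st curve_length_eq_arc_length[OF fin, of s]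
      by (auto simp: image_subset_iff)
    have 3: "?sum (\<lambda>i. max (?Q i) t) \<le> ennreal (arc_length \<gamma> 1 - arc_length \<gamma> t)"
      using sum_le_curve_length[OF mono(3), of t 1 \<gamma> n] Pin st arc_length_diff(1)[OF fin, of t 1]
      by (auto simp: image_subset_iff)
    have 2: "?sum (\<lambda>i. min (?Q i) t) \<le> ennreal (e/2)"
    proof -
      have "?sum (\<lambda>i. min (?Q i) t) \<le> (\<Sum>i<n. ennreal (e / (2 * Suc n)))"
      proof (intro sum_mono ennreal_leI less_imp_le d)
        fix i
        have "\<bar>min (?Q j) t - min (?Q k) t\<bar> \<le> t - s" for j k using st by linarith
        then show "dist (min (?Q i) t) (min (?Q (Suc i)) t) < d"
          unfolding dist_real_def using st(4) by (rule order.strict_trans1)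
        show "min (?Q i) t \<in> {0..1}" "min (?Q (Suc i)) t \<in> {0..1}" using st by auto
      qed
      also have "\<dots> = ennreal (n * (e / (2 * Suc n)))"
        using \<open>e > 0\<close> by (simp add: ennreal_of_nat_eq_real_of_nat flip: ennreal_mult)
      also have "\<dots> \<le> ennreal (e/2)"
        using \<open>e > 0\<close> by (intro ennreal_leI) (simp add: field_simps)
      finally show ?thesis .
    qed
    have le1: "arc_length \<gamma> t \<le> arc_length \<gamma> 1"
      using arc_length_diff(2)[OF fin, of t 1] st by simp
    have "?sum P \<le> ?sum (\<lambda>i. min (P i) s) + (?sum (\<lambda>i. min (?Q i) t) + ?sum (\<lambda>i. max (?Q i) t))"
      by (intro order_trans[OF sum_dist_clamp_le[OF P(1), of \<gamma> n s]] add_left_mono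
          sum_dist_clamp_le mono)
    also have "\<dots> \<le> ennreal (arc_length \<gamma> s) + (ennreal (e/2) + ennreal (arc_length \<gamma> 1 - arc_length \<gamma> t))"
      by (intro add_mono 1 2 3)
    finally have "ennreal (arc_length \<gamma> 1) \<le> ennreal (arc_length \<gamma> s)
        + (ennreal (e/2) + ennreal (arc_length \<gamma> 1 - arc_length \<gamma> t)) + ennreal (e/2)"
      using n curve_length_eq_arc_length[OF fin, of 1] by (auto intro: order_trans add_right_mono)
    also have "\<dots> = ennreal (arc_length \<gamma> s + (e/2 + (arc_length \<gamma> 1 - arc_length \<gamma> t)) + e/2)"
      using \<open>e > 0\<close> le1 by (simp flip: ennreal_plus)
    finally have "arc_length \<gamma> 1 \<le> arc_length \<gamma> s + (e/2 + (arc_length \<gamma> 1 - arc_length \<gamma> t)) + e/2"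
      using \<open>e > 0\<close> le1 by (subst (asm) ennreal_le_iff) auto
    then show "arc_length \<gamma> t - arc_length \<gamma> s \<le> e" by simp
  qed
qed

lemma continuous_on_arc_length:
  assumes "curve_length \<gamma> 0 1 < \<infinity>" "continuous_on {0..1} \<gamma>"
  shows "continuous_on {0..1} (arc_length \<gamma>)"
  unfolding continuous_on_iff
proof (intro ballI allI impI)
  fix x e :: real assume x: "x \<in> {0..1}" and "0 < e"
  obtain d where d: "d > 0"
    "\<And>s t. 0 \<le> s \<Longrightarrow> s \<le> t \<Longrightarrow> t \<le> 1 \<Longrightarrow> t - s < d \<Longrightarrow> arc_length \<gamma> t - arc_length \<gamma> s \<le> e/2"
    using arc_length_small[OF assms, of "e/2"] \<open>0 < e\<close> by auto
  have "dist (arc_length \<gamma> y) (arc_length \<gamma> x) < e" if "y \<in> {0..1}" "dist y x < d" for y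
    using d(2)[of x y] d(2)[of y x] that x \<open>0 < e\<close> arc_length_diff(2)[OF assms(1), of x y]
      arc_length_diff(2)[OF assms(1), of y x]
    by (cases "x \<le> y") (auto simp: dist_real_def)
  with d(1) show "\<exists>d>0. \<forall>y\<in>{0..1}. dist y x < d \<longrightarrow> dist (arc_length \<gamma> y) (arc_length \<gamma> x) < e"
    by blast
qed

lemma dist_le_arc_length_diff:
  assumes "curve_length \<gamma> 0 1 < \<infinity>" "s \<in> {0..1}" "t \<in> {0..1}"
  shows "dist (\<gamma> s) (\<gamma> t) \<le> \<bar>arc_length \<gamma> s - arc_length \<gamma> t\<bar>"
proof -
  have *: "dist (\<gamma> s) (\<gamma> t) \<le> arc_length \<gamma> t - arc_length \<gamma> s" if "0 \<le> s" "s \<le> t" "t \<le> 1" for s t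
    using dist_le_curve_length[of s s t t \<gamma>] arc_length_diff[OF assms(1) that] that by simp
  show ?thesis
    using *[of s t] *[of t s] assms by (cases "s \<le> t") (auto simp: dist_commute)
qed

text \<open>The intermediate value theorem for \<open>arc_length\<close> shows that the choice in
  \<open>arc_length_param\<close> is made from a nonempty set. Later proofs work with the parameter
  t obtained here and never unfold the choice.\<close>

lemma arc_length_param_ex:
  assumes "curve_length \<gamma> 0 1 < \<infinity>" "continuous_on {0..1} \<gamma>" "u \<in> {0..arc_length \<gamma> 1}"
  obtains t where "t \<in> {0..1}" "arc_length \<gamma> t = u" "arc_length_param \<gamma> u = \<gamma> t"
proof -
  define t where "t = (SOME t. t \<in> {0..1} \<and> curve_length \<gamma> 0 t = ennreal u)"
  obtain x where "0 \<le> x" "x \<le> 1" "arc_length \<gamma> x = u"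
    using IVT'[of "arc_length \<gamma>" 0 u 1] continuous_on_arc_length[OF assms(1,2)] assms(3) by auto
  then have "\<exists>t. t \<in> {0..1} \<and> curve_length \<gamma> 0 t = ennreal u"
    using curve_length_eq_arc_length[OF assms(1), of x] by auto
  from someI_ex[OF this] have "t \<in> {0..1}" "curve_length \<gamma> 0 t = ennreal u"
    unfolding t_def by auto
  then show ?thesis
    using that[of t] assms(3) unfolding arc_length_param_def arc_length_def t_def[symmetric] by simp
qed

text \<open>The choice may return another parameter of the same length, but a chord is at most the
  arc between its ends, so the two points of the curve coincide.\<close>

lemma arc_length_param_arc_length:
  assumes "curve_length \<gamma> 0 1 < \<infinity>" "continuous_on {0..1} \<gamma>" "t \<in> {0..1}"
  shows "arc_length_param \<gamma> (arc_length \<gamma> t) = \<gamma> t"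
proof -
  have "arc_length \<gamma> t \<in> {0..arc_length \<gamma> 1}"
    using arc_length_diff(2)[OF assms(1), of t 1] assms(3) by auto
  then obtain s where "s \<in> {0..1}" "arc_length \<gamma> s = arc_length \<gamma> t"
      "arc_length_param \<gamma> (arc_length \<gamma> t) = \<gamma> s"
    using arc_length_param_ex[OF assms(1,2)] by metis
  then show ?thesis
    using dist_le_arc_length_diff[OF assms(1), of s t] assms(3) by simp
qed

text \<open>This bound gives continuity, hence measurability of densities along the curve, and it
  confines initial arcs to balls.\<close>

lemma dist_arc_length_param_le:
  assumes "curve_length \<gamma> 0 1 < \<infinity>" "continuous_on {0..1} \<gamma>"
    "u \<in> {0..arc_length \<gamma> 1}" "v \<in> {0..arc_length \<gamma> 1}"
  shows "dist (arc_length_param \<gamma> u) (arc_length_param \<gamma> v) \<le> \<bar>u - v\<bar>"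
proof -
  obtain s where s: "s \<in> {0..1}" "arc_length \<gamma> s = u" "arc_length_param \<gamma> u = \<gamma> s"
    using arc_length_param_ex[OF assms(1,2,3)] by metis
  obtain t where t: "t \<in> {0..1}" "arc_length \<gamma> t = v" "arc_length_param \<gamma> v = \<gamma> t"
    using arc_length_param_ex[OF assms(1,2,4)] by metis
  show ?thesis
    using dist_le_arc_length_diff[OF assms(1) s(1) t(1)] s t by simp
qed

lemma continuous_on_arc_length_param:
  assumes "curve_length \<gamma> 0 1 < \<infinity>" "continuous_on {0..1} \<gamma>"
  shows "continuous_on {0..arc_length \<gamma> 1} (arc_length_param \<gamma>)"
  unfolding continuous_on_iff
proof (intro ballI allI impI)
  fix x e :: real assume "x \<in> {0..arc_length \<gamma> 1}" "0 < e"
  then have "dist (arc_length_param \<gamma> y) (arc_length_param \<gamma> x) < e"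
    if "y \<in> {0..arc_length \<gamma> 1}" "dist y x < e" for y
    using dist_arc_length_param_le[OF assms, of y x] that by (simp add: dist_real_def)
  with \<open>0 < e\<close> show "\<exists>d>0. \<forall>y\<in>{0..arc_length \<gamma> 1}. dist y x < d \<longrightarrow>
      dist (arc_length_param \<gamma> y) (arc_length_param \<gamma> x) < e"
    by blast
qed

section \<open>Lipschitz images and Lebesgue measure\<close>

text \<open>Not the sharp constant \<open>L ^ DIM('a)\<close>: a cube of side \<open>s\<close> is mapped into a ball of
  radius \<open>L * DIM('a) * s\<close>.\<close>

definition lipschitz_const :: "'a::euclidean_space itself \<Rightarrow> real \<Rightarrow> real"
  where "lipschitz_const _ L = unit_ball_vol (real DIM('a)) * (L * real DIM('a)) ^ DIM('a)"

lemma lipschitz_const_nonneg: "0 \<le> L \<Longrightarrow> 0 \<le> lipschitz_const TYPE('a::euclidean_space) L"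
  by (simp add: lipschitz_const_def)

lemma lipschitz_const_pos: "0 < L \<Longrightarrow> 0 < lipschitz_const TYPE('a::euclidean_space) L"
  by (simp add: lipschitz_const_def)

text \<open>S is arbitrary, so the image need not be Borel and is enclosed in a ball about the image
  of one of its points. The sum norm bounds distances within the cube by
  \<open>DIM('a) * s\<close>.\<close>

lemma emeasure_lipschitz_cube:
  fixes f :: "'a::euclidean_space \<Rightarrow> 'a"
  assumes lip: "L-lipschitz_on S f"
    and cube: "\<And>i. i \<in> Basis \<Longrightarrow> v \<bullet> i - u \<bullet> i = s" and "0 \<le> s"
  obtains B where "B \<in> sets borel" "f ` (S \<inter> cbox u v) \<subseteq> B"
    "emeasure lborel B \<le> ennreal (lipschitz_const TYPE('a) L) * emeasure lborel (cbox u v)"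
proof (cases "S \<inter> cbox u v = {}")
  case True
  then show ?thesis using that[of "{}"] by simp
next
  case False
  then obtain x where x: "x \<in> S" "x \<in> cbox u v" by auto
  let ?n = "DIM('a)"
  have "0 \<le> L" using lip by (rule lipschitz_on_nonneg)
  have "f ` (S \<inter> cbox u v) \<subseteq> cball (f x) (L * (?n * s))"
  proof clarify
    fix y assume y: "y \<in> S" "y \<in> cbox u v"
    have "dist x y \<le> (\<Sum>i\<in>Basis. \<bar>(x - y) \<bullet> i\<bar>)"
      unfolding dist_norm by (rule norm_le_l1)
    also have "\<dots> \<le> (\<Sum>i\<in>(Basis :: 'a set). s)"
    proof (rule sum_mono)
      fix i :: 'a assume "i \<in> Basis"
      then show "\<bar>(x - y) \<bullet> i\<bar> \<le> s"
        using cube[of i] x y by (fastforce simp: mem_box inner_diff_left)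
    qed
    finally have "dist x y \<le> ?n * s" by simp
    then show "f y \<in> cball (f x) (L * (?n * s))"
      using lipschitz_onD[OF lip x(1) y(1)] \<open>0 \<le> L\<close> by (simp add: mult_left_mono order.trans)
  qed
  moreover have "emeasure lborel (cball (f x) (L * (?n * s)))
      = ennreal (lipschitz_const TYPE('a) L) * emeasure lborel (cbox u v)"
  proof -
    have uv: "\<And>i. i \<in> Basis \<Longrightarrow> u \<bullet> i \<le> v \<bullet> i" using cube \<open>0 \<le> s\<close> by (metis diff_ge_0_iff_ge)
    have "emeasure lborel (cbox u v) = ennreal (s ^ ?n)"
      using uv by (simp add: emeasure_lborel_cbox_eq inner_diff_left cube)
    then show ?thesis
      using \<open>0 \<le> L\<close> \<open>0 \<le> s\<close>
      by (simp add: emeasure_cball lipschitz_const_def power_mult_distrib mult_ac flip: ennreal_mult)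
  qed
  ultimately show ?thesis
    by (intro that[of "cball (f x) (L * (?n * s))"]) auto
qed

text \<open>S is covered by countably many cubes whose union has hardly more measure than S, and the
  cube estimate is summed over them. Stating the bound for Borel parts B of the image avoids the
  question whether the image itself is Borel.\<close>

lemma emeasure_lipschitz_image_le:
  fixes f :: "'a::euclidean_space \<Rightarrow> 'a"
  assumes lip: "L-lipschitz_on S f"
    and S: "S \<in> sets borel" "bounded S" and B: "B \<in> sets borel" "B \<subseteq> f ` S"
  shows "emeasure lborel B \<le> ennreal (lipschitz_const TYPE('a) L) * emeasure lborel S"
proof -
  have "0 \<le> L" using lip by (rule lipschitz_on_nonneg)
  define C where "C = lipschitz_const TYPE('a) L"
  have "C \<ge> 0" unfolding C_def using \<open>0 \<le> L\<close> by (rule lipschitz_const_nonneg)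
  obtain k where k: "k > 0" "S \<subseteq> ball 0 k"
    using bounded_subset_ballD[OF S(2), of 0] by auto
  let ?a = "- (k *\<^sub>R One) :: 'a" and ?b = "k *\<^sub>R One :: 'a"
  have "S \<subseteq> cbox ?a ?b"
  proof
    fix x assume "x \<in> S"
    then have "norm x < k" using k by auto
    then have "\<bar>x \<bullet> i\<bar> \<le> k" if "i \<in> Basis" for i
      using Basis_le_norm[OF that, of x] by simp
    then show "x \<in> cbox ?a ?b" by (force simp: mem_box abs_le_iff)
  qed
  have S_lm: "S \<in> lmeasurable"
    using S by (simp add: bounded_set_imp_lmeasurable)
  have "emeasure lborel B \<le> ennreal (C * measure lborel S) + ennreal e" if "e > 0" for e :: real
  proof -
    \<comment> \<open>Dividing by C + 1 keeps the error C * e' below e even when C = 0.\<close>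
    define e' where "e' = e / (C + 1)"
    have e': "e' > 0" "C * e' \<le> e"
      using \<open>e > 0\<close> \<open>C \<ge> 0\<close> by (auto simp: e'_def field_simps)
    obtain \<D> where D: "countable \<D>" "\<And>K. K \<in> \<D> \<Longrightarrow> K \<subseteq> cbox ?a ?b \<and> K \<noteq> {} \<and> (\<exists>c d. K = cbox c d)"
        "pairwise (\<lambda>A B. interior A \<inter> interior B = {}) \<D>"
        "\<And>u v. cbox u v \<in> \<D> \<Longrightarrow> \<exists>n. \<forall>i \<in> Basis. v \<bullet> i - u \<bullet> i = (?b \<bullet> i - ?a \<bullet> i)/2^n"
        "S \<subseteq> \<Union>\<D>" "\<Union>\<D> \<in> lmeasurable" "measure lebesgue (\<Union>\<D>) \<le> measure lebesgue S + e'"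
      using measurable_outer_intervals_bounded[OF S_lm \<open>S \<subseteq> cbox ?a ?b\<close> e'(1)] by metis
    \<comment> \<open>Enumerates the family by all natural numbers even if it is finite; spare
      indices receive the empty set.\<close>
    define A where "A n = (if n \<in> to_nat_on \<D> ` \<D> then from_nat_into \<D> n else {})" for n
    have A: "A n \<in> insert {} \<D>" for n
      using D(1) by (auto simp: A_def)
    have UA: "\<Union>(range A) = \<Union>\<D>"
      using D(1) by (auto simp: A_def split: if_splits)
    have borelA: "A n \<in> sets borel" for n
      using A[of n] D(2) by (metis borel_closed closed_cbox insertE sets.empty_sets)
    have disj: "disjoint_family (\<lambda>n. interior (A n))"
      unfolding disjoint_family_on_def
    proof (intro ballI impI)
      fix m n :: nat assume "m \<noteq> n"
      then have "A m = {} \<or> A n = {} \<or> A m \<in> \<D> \<and> A n \<in> \<D> \<and> A m \<noteq> A n"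
        using D(1) by (auto simp: A_def)
      then show "interior (A m) \<inter> interior (A n) = {}"
        using pairwiseD[OF D(3)] by auto
    qed
    \<comment> \<open>Neighbouring cubes share faces, so the measures are summed over the interiors,
      which are disjoint and have the same measure as the cubes.\<close>
    have "\<exists>B. B \<in> sets borel \<and> f ` (S \<inter> A n) \<subseteq> B \<and>
        emeasure lborel B \<le> ennreal C * emeasure lborel (interior (A n))" for n
    proof (cases "A n = {}")
      case True
      then show ?thesis by (intro exI[of _ "{}"]) auto
    next
      case False
      then have "A n \<in> \<D>" using A[of n] by auto
      then obtain u v where uv: "A n = cbox u v" using D(2) by metis
      with \<open>A n \<in> \<D>\<close> D(4) obtain m where m: "\<forall>i \<in> Basis. v \<bullet> i - u \<bullet> i = (?b \<bullet> i - ?a \<bullet> i)/2^m"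
        by metis
      obtain B where "B \<in> sets borel" "f ` (S \<inter> cbox u v) \<subseteq> B"
          "emeasure lborel B \<le> ennreal C * emeasure lborel (cbox u v)"
        unfolding C_def
        by (rule emeasure_lipschitz_cube[OF lip, of v u "2 * k / 2 ^ m"])
           (use m k in auto)
      moreover have "emeasure lborel (box u v) = emeasure lborel (cbox u v)"
        by (simp add: emeasure_lborel_cbox_eq emeasure_lborel_box_eq)
      ultimately show ?thesis
        unfolding uv interior_cbox by (intro exI[of _ B]) simp
    qed
    then obtain E where E: "\<And>n. E n \<in> sets borel" "\<And>n. f ` (S \<inter> A n) \<subseteq> E n"
        "\<And>n. emeasure lborel (E n) \<le> ennreal C * emeasure lborel (interior (A n))"
      by metis
    have "B \<subseteq> f ` (\<Union>n. S \<inter> A n)"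
      using B(2) D(5) UA by (auto simp: Int_absorb2 simp flip: Int_UN_distrib)
    also have "\<dots> \<subseteq> \<Union>(range E)"
      unfolding image_UN by (intro UN_mono E(2)) simp
    finally have "B \<subseteq> \<Union>(range E)" .
    then have "emeasure lborel B \<le> emeasure lborel (\<Union>(range E))"
      using E(1) by (intro emeasure_mono) auto
    also have "\<dots> \<le> (\<Sum>n. emeasure lborel (E n))"
      using E(1) by (intro emeasure_subadditive_countably) auto
    also have "\<dots> \<le> (\<Sum>n. ennreal C * emeasure lborel (interior (A n)))"
      by (intro suminf_le E(3)) auto
    also have "\<dots> = ennreal C * emeasure lborel (\<Union>n. interior (A n))"
      using disj by (subst ennreal_suminf_cmult, subst suminf_emeasure) auto
    also have "\<dots> \<le> ennreal C * emeasure lborel (\<Union>\<D>)"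
      using borelA interior_subset unfolding UA[symmetric]
      by (intro mult_left_mono emeasure_mono UN_mono) auto
    also have "emeasure lborel (\<Union>\<D>) = ennreal (measure lebesgue (\<Union>\<D>))"
      using D(6) borelA unfolding UA[symmetric]
      by (subst emeasure_eq_measure2[symmetric]) auto
    also have "\<dots> \<le> ennreal (measure lborel S + e')"
      using D(7) S by (intro ennreal_leI) simp
    also have "ennreal C * ennreal (measure lborel S + e') = ennreal (C * measure lborel S + C * e')"
      using \<open>C \<ge> 0\<close> e' by (simp add: algebra_simps flip: ennreal_mult)
    also have "\<dots> \<le> ennreal (C * measure lborel S + e)"
      using e' by (intro ennreal_leI) simp
    also have "\<dots> = ennreal (C * measure lborel S) + ennreal e"
      using \<open>C \<ge> 0\<close> \<open>e > 0\<close> by simp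
    finally show ?thesis by (simp add: mult_left_mono)
  qed
  then have "emeasure lborel B \<le> ennreal (C * measure lborel S)"
    by (rule ennreal_le_epsilon)
  also have "\<dots> = ennreal C * emeasure lborel S"
    using \<open>C \<ge> 0\<close> S emeasure_bounded_finite[OF S(2)]
    by (simp add: ennreal_mult emeasure_eq_ennreal_measure)
  finally show ?thesis unfolding C_def .
qed

text \<open>A comparison of measures: by the previous lemma, Lebesgue measure on T is dominated on
  Borel sets by a multiple of the push-forward under f of Lebesgue measure on S, and the integral is
  monotone in the measure.\<close>

lemma nn_integral_lipschitz_image_le:
  fixes f :: "'a::euclidean_space \<Rightarrow> 'a"
  assumes lip: "L-lipschitz_on S f"
    and S: "S \<in> sets borel" "bounded S" and T: "T \<in> sets borel" "T \<subseteq> f ` S"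
    and g: "g \<in> borel_measurable borel"
  shows "(\<integral>\<^sup>+y\<in>T. g y \<partial>lborel)
    \<le> ennreal (lipschitz_const TYPE('a) L) * (\<integral>\<^sup>+x\<in>S. g (f x) \<partial>lborel)"
proof -
  let ?R = "restrict_space lborel S"
  define M where "M = scale_measure (ennreal (lipschitz_const TYPE('a) L)) (distr ?R borel f)"
  have "continuous_on S f"
    using lip by (rule lipschitz_on_continuous_on)
  then have f: "f \<in> measurable ?R borel"
    by (subst measurable_cong_sets[where M' = "restrict_space borel S" and N' = borel])
       (auto simp: sets_restrict_space intro: borel_measurable_continuous_on_restrict)
  have "density lborel (indicator T) \<le> M"
  proof (subst le_measure; (intro ballI)?)
    fix B assume "B \<in> sets (density lborel (indicator T))"
    then have B: "B \<in> sets borel" by simp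
    have pre: "f -` B \<inter> S \<in> sets borel"
      using measurable_sets[OF f B] S by (simp add: space_restrict_space sets_restrict_space_iff)
    have "emeasure (density lborel (indicator T)) B = emeasure lborel (T \<inter> B)"
      using T B by (simp add: emeasure_density flip: indicator_inter_arith)
    also have "\<dots> \<le> ennreal (lipschitz_const TYPE('a) L) * emeasure lborel (f -` B \<inter> S)"
    proof (rule emeasure_lipschitz_image_le)
      show "L-lipschitz_on (f -` B \<inter> S) f"
        using lip by (rule lipschitz_on_subset) simp
      show "bounded (f -` B \<inter> S)"
        using S(2) by (rule bounded_subset) simp
    qed (use pre T B in auto)
    also have "\<dots> = emeasure M B"
      using f B S pre by (simp add: M_def emeasure_distr emeasure_restrict_space space_restrict_space)
    finally show "emeasure (density lborel (indicator T)) B \<le> emeasure M B" .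
  qed (simp add: M_def)
  then have "nn_integral (density lborel (indicator T)) g \<le> nn_integral M g"
    by (rule nn_integral_mono_measure[rotated]) (simp add: M_def)
  also have "nn_integral M g = ennreal (lipschitz_const TYPE('a) L) * (\<integral>\<^sup>+x\<in>S. g (f x) \<partial>lborel)"
    unfolding M_def using f g S
    by (subst nn_integral_scale_measure) (simp_all add: nn_integral_distr nn_integral_restrict_space)
  also have "nn_integral (density lborel (indicator T)) g = (\<integral>\<^sup>+y\<in>T. g y \<partial>lborel)"
    using T g by (subst nn_integral_density) (auto simp: mult.commute)
  finally show ?thesis .
qed

section \<open>Modulus under bilipschitz maps\<close>

text \<open>Nothing is known about f outside A. Replacing it by 0 there makes it Borel, and the
  outer indicator hides the replacement.\<close>

lemma borel_measurable_comp_indicator: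
  fixes f :: "'a::topological_space \<Rightarrow> 'b::real_normed_vector" and g :: "'b \<Rightarrow> ennreal"
  assumes "continuous_on A f" "A \<in> sets borel" "g \<in> borel_measurable borel"
  shows "(\<lambda>x. g (f x) * indicator A x) \<in> borel_measurable borel"
proof -
  have "(\<lambda>x. indicator A x *\<^sub>R f x) \<in> borel_measurable borel"
    using assms(1,2) by (intro borel_measurable_continuous_on_indicator)
  from measurable_compose[OF this assms(3)]
  have "(\<lambda>x. g (indicator A x *\<^sub>R f x) * indicator A x) \<in> borel_measurable borel"
    using assms(2) by simp
  also have "(\<lambda>x. g (indicator A x *\<^sub>R f x) * indicator A x) = (\<lambda>x. g (f x) * indicator A x)"
    by (auto simp: indicator_def)
  finally show ?thesis .
qed

lemma line_integral_eq:
  "line_integral \<rho> \<gamma> = (\<integral>\<^sup>+u\<in>{0..arc_length \<gamma> 1}. \<rho> (arc_length_param \<gamma> u) \<partial>lborel)"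
  by (simp add: line_integral_def arc_length_def)

lemma arc_length_lipschitz_image:
  assumes fin: "curve_length \<gamma> 0 1 < \<infinity>" and \<sigma>: "L-lipschitz_on A \<sigma>" and A: "\<gamma> ` {0..1} \<subseteq> A"
  shows "curve_length (\<sigma> \<circ> \<gamma>) 0 1 < \<infinity>"
    and "0 \<le> s \<Longrightarrow> s \<le> t \<Longrightarrow> t \<le> 1 \<Longrightarrow>
      arc_length (\<sigma> \<circ> \<gamma>) t - arc_length (\<sigma> \<circ> \<gamma>) s \<le> L * (arc_length \<gamma> t - arc_length \<gamma> s)"
proof -
  have "L \<ge> 0" using \<sigma> by (rule lipschitz_on_nonneg)
  have le: "curve_length (\<sigma> \<circ> \<gamma>) s t \<le> ennreal L * curve_length \<gamma> s t" if "0 \<le> s" "t \<le> 1" for s t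
  proof (rule curve_length_lipschitz_le)
    fix x y assume "x \<in> {s..t}" "y \<in> {s..t}"
    then have "\<gamma> x \<in> A" "\<gamma> y \<in> A" using A that by auto
    then show "dist ((\<sigma> \<circ> \<gamma>) x) ((\<sigma> \<circ> \<gamma>) y) \<le> L * dist (\<gamma> x) (\<gamma> y)"
      using lipschitz_onD[OF \<sigma>] by simp
  qed
  show fin': "curve_length (\<sigma> \<circ> \<gamma>) 0 1 < \<infinity>"
    using le[of 0 1] fin by (simp add: ennreal_mult_less_top order.strict_trans1)
  assume "0 \<le> s" "s \<le> t" "t \<le> 1"
  then show "arc_length (\<sigma> \<circ> \<gamma>) t - arc_length (\<sigma> \<circ> \<gamma>) s \<le> L * (arc_length \<gamma> t - arc_length \<gamma> s)"
    using le[of s t] \<open>L \<ge> 0\<close> arc_length_diff[OF fin, of s t] arc_length_diff[OF fin', of s t]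
    by (simp flip: ennreal_mult)
qed

text \<open>The change of variables in dimension one, applied to the passage between the two arc
  lengths. The indicator costs nothing because \<open>\<gamma>\<close> stays in A, and it turns the
  integrand into a density on the whole plane that is Borel for compact A.\<close>

lemma line_integral_lipschitz_image_le:
  assumes fin: "curve_length \<gamma> 0 1 < \<infinity>" and cont: "continuous_on {0..1} \<gamma>"
    and \<sigma>: "L-lipschitz_on A \<sigma>" and A: "\<gamma> ` {0..1} \<subseteq> A"
    and \<rho>: "\<rho> \<in> borel_measurable borel"
  shows "line_integral \<rho> (\<sigma> \<circ> \<gamma>)
    \<le> ennreal (lipschitz_const TYPE(real) L) * line_integral (\<lambda>z. \<rho> (\<sigma> z) * indicator A z) \<gamma>"
proof -
  define \<delta> where "\<delta> = \<sigma> \<circ> \<gamma>"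
  note fin' = arc_length_lipschitz_image(1)[OF fin \<sigma> A, folded \<delta>_def]
  note lip = arc_length_lipschitz_image(2)[OF fin \<sigma> A, folded \<delta>_def]
  have cont': "continuous_on {0..1} \<delta>"
    unfolding \<delta>_def using A lipschitz_on_continuous_on[OF \<sigma>]
    by (intro continuous_on_compose cont) (rule continuous_on_subset)
  let ?S = "{0..arc_length \<gamma> 1}" and ?T = "{0..arc_length \<delta> 1}"
  have "\<forall>u\<in>?S. \<exists>t. t \<in> {0..1} \<and> arc_length \<gamma> t = u \<and> arc_length_param \<gamma> u = \<gamma> t"
    using arc_length_param_ex[OF fin cont] by metis
  then obtain \<tau> where \<tau>: "\<And>u. u \<in> ?S \<Longrightarrow> \<tau> u \<in> {0..1}" "\<And>u. u \<in> ?S \<Longrightarrow> arc_length \<gamma> (\<tau> u) = u"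
      "\<And>u. u \<in> ?S \<Longrightarrow> arc_length_param \<gamma> u = \<gamma> (\<tau> u)"
    by metis
  \<comment> \<open>the passage from the arc length of \<open>\<gamma>\<close> to that of \<open>\<delta>\<close> is itself Lipschitz\<close>
  define \<phi> where "\<phi> u = arc_length \<delta> (\<tau> u)" for u
  have lip': "dist (arc_length \<delta> s) (arc_length \<delta> t) \<le> L * dist (arc_length \<gamma> s) (arc_length \<gamma> t)"
    if "s \<in> {0..1}" "t \<in> {0..1}" for s t
  proof (cases "s \<le> t")
    case True
    then show ?thesis
      using lip[of s t] arc_length_diff(2)[OF fin, of s t] arc_length_diff(2)[OF fin', of s t] that
      by (simp add: dist_real_def)
  next
    case False
    then show ?thesis
      using lip[of t s] arc_length_diff(2)[OF fin, of t s] arc_length_diff(2)[OF fin', of t s] that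
      by (simp add: dist_real_def)
  qed
  have \<phi>: "L-lipschitz_on ?S \<phi>"
  proof (rule lipschitz_onI)
    fix u v assume "u \<in> ?S" "v \<in> ?S"
    then show "dist (\<phi> u) (\<phi> v) \<le> L * dist u v"
      using lip'[of "\<tau> u" "\<tau> v"] \<tau> by (simp add: \<phi>_def)
  qed (use \<sigma> in \<open>rule lipschitz_on_nonneg\<close>)
  have surj: "?T \<subseteq> \<phi> ` ?S"
  proof
    fix v assume "v \<in> ?T"
    then obtain t where t: "t \<in> {0..1}" "arc_length \<delta> t = v"
      using arc_length_param_ex[OF fin' cont'] by metis
    let ?u = "arc_length \<gamma> t"
    have u: "?u \<in> ?S" using arc_length_diff(2)[OF fin, of t 1] t by auto
    \<comment> \<open>\<open>\<tau>\<close> may choose another parameter than t. Both have the same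
      length along \<open>\<gamma>\<close>, so \<open>lip'\<close> gives them equal lengths along
      \<open>\<delta>\<close>.\<close>
    have "\<phi> ?u = v"
      using lip'[OF \<tau>(1)[OF u] t(1)] \<tau>(2)[OF u] t by (simp add: \<phi>_def)
    with u show "v \<in> \<phi> ` ?S" by blast
  qed
  \<comment> \<open>Truncation makes g Borel: continuity of the arc length parametrization of
    \<open>\<delta>\<close> is known only on \<open>?T\<close>.\<close>
  define g where "g v = \<rho> (arc_length_param \<delta> v) * indicator ?T v" for v
  have g: "g \<in> borel_measurable borel"
    unfolding g_def
    by (intro borel_measurable_comp_indicator continuous_on_arc_length_param fin' cont' \<rho>) auto
  have "line_integral \<rho> \<delta> = (\<integral>\<^sup>+v\<in>?T. g v \<partial>lborel)"
    unfolding line_integral_eq g_def by (intro nn_integral_cong) (auto simp: indicator_def)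
  also have "\<dots> \<le> ennreal (lipschitz_const TYPE(real) L) * (\<integral>\<^sup>+u\<in>?S. g (\<phi> u) \<partial>lborel)"
    by (intro nn_integral_lipschitz_image_le \<phi> surj g) auto
  also have "(\<integral>\<^sup>+u\<in>?S. g (\<phi> u) \<partial>lborel) \<le> line_integral (\<lambda>z. \<rho> (\<sigma> z) * indicator A z) \<gamma>"
    unfolding line_integral_eq
  proof (intro nn_integral_mono)
    fix u
    show "g (\<phi> u) * indicator ?S u
        \<le> \<rho> (\<sigma> (arc_length_param \<gamma> u)) * indicator A (arc_length_param \<gamma> u) * indicator ?S u"
    proof (cases "u \<in> ?S")
      case True
      then have "arc_length_param \<delta> (\<phi> u) = \<sigma> (arc_length_param \<gamma> u)" "arc_length_param \<gamma> u \<in> A"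
        using \<tau>[of u] A arc_length_param_arc_length[OF fin' cont', of "\<tau> u"]
        by (auto simp: \<phi>_def \<delta>_def)
      then show ?thesis by (simp add: g_def indicator_def)
    qed simp
  qed
  finally show ?thesis
    unfolding \<delta>_def by (simp add: mult_left_mono)
qed

text \<open>A positive finite factor can be moved across by multiplying with 1/c.\<close>

lemma ennreal_le_mult_INF:
  fixes f :: "'a \<Rightarrow> ennreal"
  assumes "0 < c" "\<And>i. i \<in> I \<Longrightarrow> x \<le> ennreal c * f i"
  shows "x \<le> ennreal c * (INF i\<in>I. f i)"
proof -
  have c: "ennreal (1/c) * ennreal c = 1" "ennreal c * ennreal (1/c) = 1"
    using \<open>0 < c\<close> by (simp_all flip: ennreal_mult)
  have "ennreal (1/c) * x \<le> (INF i\<in>I. f i)"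
  proof (rule INF_greatest)
    fix i assume "i \<in> I"
    from mult_left_mono[OF assms(2)[OF this], of "ennreal (1/c)"]
    show "ennreal (1/c) * x \<le> f i" using c by (simp flip: mult.assoc)
  qed
  from mult_left_mono[OF this, of "ennreal c"] show ?thesis
    using c by (simp flip: mult.assoc)
qed

text \<open>The first factor is the constant for line integrals; it scales the density and is
  squared together with it. The second is the cost of the change of area under the inverse
  map.\<close>

definition bilipschitz_const :: "real \<Rightarrow> real"
  where "bilipschitz_const L = (lipschitz_const TYPE(real) L)\<^sup>2 * lipschitz_const TYPE(complex) L"

lemma bilipschitz_const_pos: "0 < L \<Longrightarrow> 0 < bilipschitz_const L"
  unfolding bilipschitz_const_def
  by (intro mult_pos_pos zero_less_power lipschitz_const_pos)

text \<open>A density \<open>\<rho>\<close> admissible for the image curves pulls back to a multiple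
  of \<open>\<rho> \<circ> \<sigma>\<close> on A, which is admissible for the original curves.
  Compactness makes A and its image Borel and the image bounded, as the change of variables
  requires.\<close>

lemma curve_modulus_bilipschitz_le:
  assumes A: "compact A" and "0 < L" and \<sigma>: "L-lipschitz_on A \<sigma>"
    and inv: "\<And>z w. z \<in> A \<Longrightarrow> w \<in> A \<Longrightarrow> dist z w \<le> L * dist (\<sigma> z) (\<sigma> w)"
    and F: "\<And>\<beta>. \<beta> \<in> F \<Longrightarrow> continuous_on {0..1} \<beta>" "\<And>\<beta>. \<beta> \<in> F \<Longrightarrow> \<beta> ` {0..1} \<subseteq> A"
  shows "curve_modulus ((\<lambda>\<beta>. Some \<circ> \<beta>) ` F)
    \<le> ennreal (bilipschitz_const L) * curve_modulus ((\<lambda>\<beta>. Some \<circ> (\<sigma> \<circ> \<beta>)) ` F)"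
  unfolding curve_modulus_def[of "(\<lambda>\<beta>. Some \<circ> (\<sigma> \<circ> \<beta>)) ` F"]
proof (rule ennreal_le_mult_INF)
  define C where "C = lipschitz_const TYPE(real) L"
  have C: "C > 0" "lipschitz_const TYPE(complex) L > 0"
    using \<open>0 < L\<close> by (auto simp: C_def lipschitz_const_pos)
  show "0 < bilipschitz_const L" using \<open>0 < L\<close> by (rule bilipschitz_const_pos)
  fix \<rho> assume "\<rho> \<in> {\<rho>. admissible_density ((\<lambda>\<beta>. Some \<circ> (\<sigma> \<circ> \<beta>)) ` F) \<rho>}"
  then have \<rho>: "\<rho> \<in> borel_measurable borel"
    and adm: "\<And>\<beta>. \<beta> \<in> F \<Longrightarrow> curve_length (\<sigma> \<circ> \<beta>) 0 1 < \<infinity> \<Longrightarrow> 1 \<le> line_integral \<rho> (\<sigma> \<circ> \<beta>)"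
    by (auto simp: admissible_density_def comp_def image_def)
  define \<rho>\<^sub>0 where "\<rho>\<^sub>0 z = \<rho> (\<sigma> z) * indicator A z" for z
  have cont: "continuous_on A \<sigma>" using \<sigma> by (rule lipschitz_on_continuous_on)
  have \<rho>\<^sub>0: "\<rho>\<^sub>0 \<in> borel_measurable borel"
    unfolding \<rho>\<^sub>0_def using A by (intro borel_measurable_comp_indicator cont \<rho>) (simp add: borel_compact)
  have sq: "(\<lambda>z. (\<rho>\<^sub>0 z)\<^sup>2) \<in> borel_measurable borel"
    unfolding power2_eq_square by (intro borel_measurable_times_ennreal \<rho>\<^sub>0)
  have "admissible_density ((\<lambda>\<beta>. Some \<circ> \<beta>) ` F) (\<lambda>z. ennreal C * \<rho>\<^sub>0 z)"
    unfolding admissible_density_def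
  proof (intro conjI ballI impI)
    show "(\<lambda>z. ennreal C * \<rho>\<^sub>0 z) \<in> borel_measurable borel" using \<rho>\<^sub>0 by simp
    fix \<gamma> assume "\<gamma> \<in> (\<lambda>\<beta>. Some \<circ> \<beta>) ` F" and len: "curve_length (the \<circ> \<gamma>) 0 1 < \<infinity>"
    then obtain \<beta> where \<beta>: "\<beta> \<in> F" "the \<circ> \<gamma> = \<beta>" by (auto simp: comp_def)
    then have fin: "curve_length \<beta> 0 1 < \<infinity>" using len by simp
    \<comment> \<open>Admissibility constrains \<open>\<rho>\<close> only on rectifiable curves, so
      rectifiability is first carried from \<open>\<beta>\<close> to its image.\<close>
    have "1 \<le> line_integral \<rho> (\<sigma> \<circ> \<beta>)"
      using \<beta>(1) arc_length_lipschitz_image(1)[OF fin \<sigma> F(2)] by (intro adm) auto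
    also have "\<dots> \<le> ennreal C * line_integral \<rho>\<^sub>0 \<beta>"
      unfolding C_def \<rho>\<^sub>0_def using \<beta>(1) fin
      by (intro line_integral_lipschitz_image_le \<sigma> \<rho> F)
    also have "\<dots> = line_integral (\<lambda>z. ennreal C * \<rho>\<^sub>0 z) \<beta>"
    proof -
      have "(\<lambda>u. \<rho>\<^sub>0 (arc_length_param \<beta> u) * indicator {0..arc_length \<beta> 1} u) \<in> borel_measurable borel"
        using \<beta>(1) fin by (intro borel_measurable_comp_indicator continuous_on_arc_length_param F \<rho>\<^sub>0) auto
      then show ?thesis
        by (simp add: line_integral_eq nn_integral_cmult[symmetric] mult.assoc)
    qed
    finally show "1 \<le> line_integral (\<lambda>z. ennreal C * \<rho>\<^sub>0 z) (the \<circ> \<gamma>)" using \<beta> by simp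
  qed
  then have "curve_modulus ((\<lambda>\<beta>. Some \<circ> \<beta>) ` F) \<le> (\<integral>\<^sup>+z. (ennreal C * \<rho>\<^sub>0 z)\<^sup>2 \<partial>lborel)"
    unfolding curve_modulus_def by (intro INF_lower) simp
  also have "\<dots> = (ennreal C)\<^sup>2 * (\<integral>\<^sup>+z\<in>A. (\<rho>\<^sub>0 z)\<^sup>2 \<partial>lborel)"
  proof -
    have "(\<integral>\<^sup>+z. (ennreal C * \<rho>\<^sub>0 z)\<^sup>2 \<partial>lborel)
        = (\<integral>\<^sup>+z. (ennreal C)\<^sup>2 * ((\<rho>\<^sub>0 z)\<^sup>2 * indicator A z) \<partial>lborel)"
      by (intro nn_integral_cong) (simp add: power_mult_distrib \<rho>\<^sub>0_def indicator_def)
    also have "\<dots> = (ennreal C)\<^sup>2 * (\<integral>\<^sup>+z\<in>A. (\<rho>\<^sub>0 z)\<^sup>2 \<partial>lborel)"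
      using sq A by (intro nn_integral_cmult borel_measurable_times_ennreal borel_measurable_indicator)
        (simp_all add: borel_compact)
    finally show ?thesis .
  qed
  also have "(\<integral>\<^sup>+z\<in>A. (\<rho>\<^sub>0 z)\<^sup>2 \<partial>lborel)
      \<le> ennreal (lipschitz_const TYPE(complex) L) * (\<integral>\<^sup>+w\<in>\<sigma> ` A. (\<rho>\<^sub>0 (inv_into A \<sigma> w))\<^sup>2 \<partial>lborel)"
  \<comment> \<open>The area is changed by the inverse of \<open>\<sigma>\<close>, which is
    L-Lipschitz by \<open>inv\<close> and maps the image of A back onto A.\<close>
  proof (rule nn_integral_lipschitz_image_le)
    have inj: "inj_on \<sigma> A" using inv by (force simp: inj_on_def)
    show "L-lipschitz_on (\<sigma> ` A) (inv_into A \<sigma>)"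
      using \<open>0 < L\<close> inv inj by (auto simp: lipschitz_on_def)
    have "compact (\<sigma> ` A)" using cont A by (rule compact_continuous_image)
    then show "\<sigma> ` A \<in> sets borel" "bounded (\<sigma> ` A)" by (auto simp: borel_compact compact_imp_bounded)
    show "A \<in> sets borel" "A \<subseteq> inv_into A \<sigma> ` \<sigma> ` A" using A inj by (auto simp: borel_compact)
    show "(\<lambda>z. (\<rho>\<^sub>0 z)\<^sup>2) \<in> borel_measurable borel" by (rule sq)
  qed
  also have "(\<integral>\<^sup>+w\<in>\<sigma> ` A. (\<rho>\<^sub>0 (inv_into A \<sigma> w))\<^sup>2 \<partial>lborel) \<le> (\<integral>\<^sup>+w. (\<rho> w)\<^sup>2 \<partial>lborel)"
    by (intro nn_integral_mono) (auto simp: \<rho>\<^sub>0_def indicator_def f_inv_into_f inv_into_into)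
  finally show "curve_modulus ((\<lambda>\<beta>. Some \<circ> \<beta>) ` F)
      \<le> ennreal (bilipschitz_const L) * (\<integral>\<^sup>+w. (\<rho> w)\<^sup>2 \<partial>lborel)"
    using C by (simp add: bilipschitz_const_def C_def mult_left_mono mult.assoc ennreal_mult ennreal_power)
qed

section \<open>Two modulus estimates and reflection in a circle or line\<close>

text \<open>A curve that starts in \<open>cball c R\<close> and gets m away from its start has an
  initial arc of length m. That arc stays in \<open>cball c (R + m)\<close>, and the constant 1/m
  integrates to 1 along it. Curves through infinity constrain no density, so the hypotheses concern
  finite curves only.\<close>

lemma curve_modulus_long_curves_le:
  assumes "0 < m" "0 \<le> R"
    and \<Gamma>: "\<And>\<gamma>. \<gamma> \<in> \<Gamma> \<Longrightarrow> None \<notin> \<gamma> ` {0..1} \<Longrightarrow> continuous_on {0..1} (the \<circ> \<gamma>)"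
      "\<And>\<gamma>. \<gamma> \<in> \<Gamma> \<Longrightarrow> None \<notin> \<gamma> ` {0..1} \<Longrightarrow> the (\<gamma> 0) \<in> cball c R"
      "\<And>\<gamma>. \<gamma> \<in> \<Gamma> \<Longrightarrow> None \<notin> \<gamma> ` {0..1} \<Longrightarrow> \<exists>t\<in>{0..1}. m \<le> dist (the (\<gamma> 0)) (the (\<gamma> t))"
  shows "curve_modulus \<Gamma> \<le> ennreal (pi * ((R + m) / m)\<^sup>2)"
proof -
  define \<rho> :: "complex \<Rightarrow> ennreal" where "\<rho> z = ennreal (1/m) * indicator (cball c (R + m)) z" for z
  have "admissible_density \<Gamma> \<rho>"
    unfolding admissible_density_def
  proof (intro conjI ballI impI)
    show "\<rho> \<in> borel_measurable borel"
      unfolding \<rho>_def by (intro borel_measurable_times_ennreal borel_measurable_indicator) auto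
    fix \<gamma> assume \<gamma>: "\<gamma> \<in> \<Gamma>" "None \<notin> \<gamma> ` {0..1}" and fin: "curve_length (the \<circ> \<gamma>) 0 1 < \<infinity>"
    define \<delta> where "\<delta> = the \<circ> \<gamma>"
    note cont = \<Gamma>(1)[OF \<gamma>, folded \<delta>_def] and fin = fin[folded \<delta>_def]
    obtain t where t: "t \<in> {0..1}" "m \<le> dist (\<delta> 0) (\<delta> t)"
      using \<Gamma>(3)[OF \<gamma>] by (auto simp: \<delta>_def)
    have "m \<le> arc_length \<delta> t"
      using dist_le_arc_length_diff[OF fin, of 0 t] t by simp
    also have "\<dots> \<le> arc_length \<delta> 1"
      using arc_length_diff(2)[OF fin, of t 1] t by simp
    finally have m: "m \<le> arc_length \<delta> 1" .
    have in_ball: "arc_length_param \<delta> u \<in> cball c (R + m)" if "u \<in> {0..m}" for u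
    proof -
      have "arc_length_param \<delta> 0 = \<delta> 0"
        using arc_length_param_arc_length[OF fin cont, of 0] by simp
      then have "dist (\<delta> 0) (arc_length_param \<delta> u) \<le> m"
        using dist_arc_length_param_le[OF fin cont, of 0 u] that m \<open>0 < m\<close> by simp
      then show ?thesis
        using \<Gamma>(2)[OF \<gamma>] dist_triangle[of c "arc_length_param \<delta> u" "\<delta> 0"] by (simp add: \<delta>_def)
    qed
    have "1 = (\<integral>\<^sup>+u. ennreal (1/m) * indicator {0..m} u \<partial>lborel)"
      using \<open>0 < m\<close> by (subst nn_integral_cmult) (auto simp flip: ennreal_mult)
    also have "\<dots> \<le> line_integral \<rho> \<delta>"
      unfolding line_integral_def
      using in_ball m by (intro nn_integral_mono) (auto simp: \<rho>_def indicator_def arc_length_def)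
    finally show "1 \<le> line_integral \<rho> (the \<circ> \<gamma>)" unfolding \<delta>_def .
  qed
  then have "curve_modulus \<Gamma> \<le> (\<integral>\<^sup>+z. (\<rho> z)\<^sup>2 \<partial>lborel)"
    unfolding curve_modulus_def by (intro INF_lower) simp
  also have "\<dots> = (\<integral>\<^sup>+z. ennreal ((1/m)\<^sup>2) * indicator (cball c (R + m)) z \<partial>lborel)"
    using \<open>0 < m\<close> by (intro nn_integral_cong) (auto simp: \<rho>_def indicator_def ennreal_power)
  also have "\<dots> = ennreal ((1/m)\<^sup>2) * emeasure lborel (cball c (R + m))"
    by (rule nn_integral_cmult_indicator) simp
  also have "\<dots> = ennreal (pi * ((R + m) / m)\<^sup>2)"
    using assms(1,2)
    by (simp add: emeasure_cball unit_ball_vol_2 power_divide field_simps flip: ennreal_mult)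
  finally show ?thesis .
qed

section \<open>Length-area estimate for vertical segments\<close>

lemma lborel_complex_eq_distr:
  "(lborel :: complex measure) = distr (lborel \<Otimes>\<^sub>M lborel) borel (\<lambda>(x, y). Complex x y)"
proof (rule lborel_eqI)
  have meas: "(\<lambda>(x, y). Complex x y) \<in> measurable (lborel \<Otimes>\<^sub>M lborel) borel"
    unfolding Complex_eq case_prod_beta' by measurable
  fix l u :: complex
  assume le: "\<And>b. b \<in> Basis \<Longrightarrow> l \<bullet> b \<le> u \<bullet> b"
  have le: "Re l \<le> Re u" "Im l \<le> Im u" using le[of 1] le[of \<i>] by (auto simp: Basis_complex_def)
  have "(\<lambda>(x, y). Complex x y) -` box l u \<inter> space (lborel \<Otimes>\<^sub>M lborel)
      = {Re l<..<Re u} \<times> {Im l<..<Im u}"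
    by (auto simp: box_def Basis_complex_def space_pair_measure)
  then show "emeasure (distr (lborel \<Otimes>\<^sub>M lborel) borel (\<lambda>(x, y). Complex x y)) (box l u)
      = ennreal (\<Prod>b\<in>Basis. (u - l) \<bullet> b)"
    using meas le
    by (simp add: emeasure_distr lborel.emeasure_pair_measure_Times Basis_complex_def flip: ennreal_mult)
qed simp

lemma nn_integral_lborel_complex:
  fixes f :: "complex \<Rightarrow> ennreal"
  assumes [measurable]: "f \<in> borel_measurable borel"
  shows "(\<integral>\<^sup>+z. f z \<partial>lborel) = (\<integral>\<^sup>+x. \<integral>\<^sup>+y. f (Complex x y) \<partial>lborel \<partial>lborel)"
proof -
  have [measurable]: "(\<lambda>(x, y). Complex x y) \<in> measurable (lborel \<Otimes>\<^sub>M lborel) borel"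
    unfolding Complex_eq case_prod_beta' by measurable
  have "(\<integral>\<^sup>+z. f z \<partial>lborel) = (\<integral>\<^sup>+p. f (case p of (x, y) \<Rightarrow> Complex x y) \<partial>(lborel \<Otimes>\<^sub>M lborel))"
    by (subst lborel_complex_eq_distr) (rule nn_integral_distr; simp)
  also have "\<dots> = (\<integral>\<^sup>+x. \<integral>\<^sup>+y. f (Complex x y) \<partial>lborel \<partial>lborel)"
    by (subst lborel.nn_integral_fst[symmetric]) (simp_all add: case_prod_beta')
  finally show ?thesis .
qed

text \<open>The segment is traversed downwards at constant speed 2h, so its polygonal sums
  telescope.\<close>

lemma curve_length_vertical_segment:
  assumes "0 < h" and \<beta>: "\<beta> = (\<lambda>t. Complex x (h * (1 - 2 * t)))" and "0 \<le> t"
  shows "curve_length \<beta> 0 t = ennreal (2 * h * t)"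
proof -
  have dist: "dist (\<beta> s) (\<beta> t) = 2 * h * (t - s)" if "s \<le> t" for s t
  proof -
    have "\<beta> s - \<beta> t = Complex 0 (2 * h * (t - s))" by (simp add: \<beta> complex_eq_iff algebra_simps)
    then show ?thesis using that \<open>0 < h\<close> by (simp add: dist_norm cmod_def)
  qed
  show ?thesis
  proof (rule antisym)
    show "curve_length \<beta> 0 t \<le> ennreal (2 * h * t)"
    proof (rule curve_length_leI)
      fix n :: nat and T :: "nat \<Rightarrow> real" assume T: "mono T" "range T \<subseteq> {0..t}"
      then have Tin: "T i \<in> {0..t}" for i by blast
      have "dist (\<beta> (T i)) (\<beta> (T (Suc i))) = 2 * h * T (Suc i) - 2 * h * T i" for i
        using dist[of "T i" "T (Suc i)"] T(1) by (simp add: monoD algebra_simps)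
      then have "(\<Sum>i<n. dist (\<beta> (T i)) (\<beta> (T (Suc i)))) = 2 * h * T n - 2 * h * T 0"
        by (simp add: sum_lessThan_telescope[of "\<lambda>i. 2 * h * T i"])
      also have "\<dots> \<le> 2 * h * t"
        using Tin[of n] Tin[of 0] \<open>0 < h\<close> mult_left_mono[of "T n - T 0" t "2 * h"]
        by (simp add: algebra_simps)
      finally show "(\<Sum>i<n. ennreal (dist (\<beta> (T i)) (\<beta> (T (Suc i))))) \<le> ennreal (2 * h * t)"
        by (simp add: ennreal_leI)
    qed
    show "ennreal (2 * h * t) \<le> curve_length \<beta> 0 t"
      using dist_le_curve_length[of 0 0 t t \<beta>] dist[of 0 t] \<open>0 \<le> t\<close> by simp
  qed
qed

lemma line_integral_vertical_segment:
  assumes "0 < h" and \<beta>: "\<beta> = (\<lambda>t. Complex x (h * (1 - 2 * t)))"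
  shows "line_integral \<rho> \<beta> = (\<integral>\<^sup>+s\<in>{0..2*h}. \<rho> (Complex x (h - s)) \<partial>lborel)"
proof -
  note len = curve_length_vertical_segment[OF assms]
  have fin: "curve_length \<beta> 0 1 < \<infinity>" using len[of 1] by simp
  have cont: "continuous_on {0..1} \<beta>"
    unfolding \<beta> Complex_eq by (intro continuous_intros)
  have al: "arc_length \<beta> t = 2 * h * t" if "0 \<le> t" for t
    using len[OF that] that \<open>0 < h\<close> by (simp add: arc_length_def)
  have "arc_length_param \<beta> s = Complex x (h - s)" if "s \<in> {0..2*h}" for s
  proof -
    have "s / (2 * h) \<in> {0..1}" using that \<open>0 < h\<close> by simp
    then show ?thesis
      using arc_length_param_arc_length[OF fin cont, of "s / (2 * h)"] al[of "s / (2 * h)"] \<open>0 < h\<close>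
      by (simp add: \<beta> field_simps)
  qed
  then show ?thesis
    unfolding line_integral_def using al[of 1]
    by (intro nn_integral_cong) (auto simp: indicator_def arc_length_def)
qed

text \<open>The length-area argument: Cauchy-Schwarz against the indicator of the segment over x
  turns admissibility into the lower bound 1/l for the integral of the squared density over the
  vertical line, and Fubini integrates this over x.\<close>

lemma curve_modulus_vertical_segments_ge:
  assumes h: "\<And>x. x \<in> {a..b} \<Longrightarrow> 0 < h x" "\<And>x. x \<in> {a..b} \<Longrightarrow> 2 * h x \<le> l" and "a \<le> b" "0 < l"
  shows "ennreal ((b - a) / l)
    \<le> curve_modulus ((\<lambda>x. Some \<circ> (\<lambda>t. Complex x (h x * (1 - 2 * t)))) ` {a..b})"
  unfolding curve_modulus_def
proof (rule INF_greatest)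
  let ?\<Gamma> = "(\<lambda>x. Some \<circ> (\<lambda>t. Complex x (h x * (1 - 2 * t)))) ` {a..b}"
  fix \<rho> assume "\<rho> \<in> {\<rho>. admissible_density ?\<Gamma> \<rho>}"
  then have \<rho>[measurable]: "\<rho> \<in> borel_measurable borel"
    and adm: "\<And>\<gamma>. \<gamma> \<in> ?\<Gamma> \<Longrightarrow> None \<notin> \<gamma> ` {0..1} \<Longrightarrow> curve_length (the \<circ> \<gamma>) 0 1 < \<infinity> \<Longrightarrow>
      1 \<le> line_integral \<rho> (the \<circ> \<gamma>)"
    by (auto simp: admissible_density_def)
  have cx: "(\<lambda>y. Complex x (f y)) \<in> borel_measurable borel" if "f \<in> borel_measurable borel" for x and f :: "real \<Rightarrow> real"
    unfolding Complex_eq using that by measurable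
  have slice: "ennreal (1 / l) \<le> (\<integral>\<^sup>+y. (\<rho> (Complex x y))\<^sup>2 \<partial>lborel)" if x: "x \<in> {a..b}" for x
  proof -
    define \<beta> where "\<beta> = (\<lambda>t. Complex x (h x * (1 - 2 * t)))"
    have "1 \<le> line_integral \<rho> (the \<circ> (Some \<circ> \<beta>))"
    proof (rule adm)
      show "Some \<circ> \<beta> \<in> ?\<Gamma>" using x by (auto simp: \<beta>_def)
      show "curve_length (the \<circ> (Some \<circ> \<beta>)) 0 1 < \<infinity>"
        using curve_length_vertical_segment[OF h(1)[OF x] \<beta>_def, of 1] by (simp add: comp_def)
    qed auto
    then have "1 \<le> line_integral \<rho> \<beta>" by (simp add: comp_def)
    then have "1 \<le> (\<integral>\<^sup>+s. \<rho> (Complex x (h x - s)) * indicator {0..2 * h x} s \<partial>lborel)"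
      using line_integral_vertical_segment[OF h(1)[OF x] \<beta>_def] by simp
    then have "1 \<le> (\<integral>\<^sup>+s. \<rho> (Complex x (h x - s)) * indicator {0..2 * h x} s \<partial>lborel)\<^sup>2"
      by (simp add: one_le_power)
    also have "\<dots> \<le> (\<integral>\<^sup>+s. (\<rho> (Complex x (h x - s)))\<^sup>2 \<partial>lborel)
        * (\<integral>\<^sup>+s. (indicator {0..2 * h x} s)\<^sup>2 \<partial>lborel)"
      using measurable_compose[OF cx \<rho>, of "\<lambda>s. h x - s"]
      by (intro Cauchy_Schwarz_nn_integral) auto
    also have "(\<integral>\<^sup>+s. (\<rho> (Complex x (h x - s)))\<^sup>2 \<partial>lborel) = (\<integral>\<^sup>+y. (\<rho> (Complex x y))\<^sup>2 \<partial>lborel)"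
      using measurable_compose[OF cx \<rho>, of "\<lambda>s. s"]
      by (subst nn_integral_real_affine[of _ "-1" "h x"]) auto
    also have "(\<integral>\<^sup>+s. (indicator {0..2 * h x} s)\<^sup>2 \<partial>lborel) = ennreal (2 * h x)"
    proof -
      have "(\<lambda>s. (indicator {0..2 * h x} s)\<^sup>2) = (indicator {0..2 * h x} :: real \<Rightarrow> ennreal)"
        by (auto simp: indicator_def fun_eq_iff)
      then show ?thesis using h(1)[OF x] by simp
    qed
    also have "\<dots> \<le> ennreal l"
      using h(2)[OF x] by (rule ennreal_leI)
    finally have "1 \<le> (\<integral>\<^sup>+y. (\<rho> (Complex x y))\<^sup>2 \<partial>lborel) * ennreal l"
      by (simp add: mult_left_mono)
    from mult_right_mono[OF this, of "ennreal (1/l)"] show ?thesis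
      using \<open>0 < l\<close> by (simp add: mult.assoc flip: ennreal_mult)
  qed
  have "ennreal ((b - a) / l) = (\<integral>\<^sup>+x. ennreal (1 / l) * indicator {a..b} x \<partial>lborel)"
    using \<open>a \<le> b\<close> \<open>0 < l\<close> by (subst nn_integral_cmult) (auto simp flip: ennreal_mult)
  also have "\<dots> \<le> (\<integral>\<^sup>+x. \<integral>\<^sup>+y. (\<rho> (Complex x y))\<^sup>2 \<partial>lborel \<partial>lborel)"
    using slice by (intro nn_integral_mono) (auto simp: indicator_def)
  also have "\<dots> = (\<integral>\<^sup>+z. (\<rho> z)\<^sup>2 \<partial>lborel)"
    by (rule nn_integral_lborel_complex[symmetric]) simp
  finally show "ennreal ((b - a) / l) \<le> (\<integral>\<^sup>+z. (\<rho> z)\<^sup>2 \<partial>lborel)" .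
qed

text \<open>Inversion is bilipschitz only away from the center, hence the compact set \<open>N\<close> to be avoided.\<close>

lemma disk_reflection:
  assumes "disk_or_half_plane U"
  obtains \<sigma> N where "compact N" "N \<subseteq> U" "\<And>z. z \<in> closure U - N \<Longrightarrow> \<sigma> z \<notin> U"
    "\<And>z. z \<in> closure U - U \<Longrightarrow> \<sigma> z = z" "4-lipschitz_on (closure U - N) \<sigma>"
    "\<And>z w. z \<in> closure U - N \<Longrightarrow> w \<in> closure U - N \<Longrightarrow> dist z w \<le> 4 * dist (\<sigma> z) (\<sigma> w)"
  using assms unfolding disk_or_half_plane_def
proof (elim disjE exE conjE)
  fix c :: complex and r :: real assume r: "0 < r" and U: "U = ball c r"
  define \<sigma> where "\<sigma> z = c + of_real (r\<^sup>2) / cnj (z - c)" for z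
  have cl: "z \<in> closure U - cball c (r/2) \<longleftrightarrow> r / 2 < norm (z - c) \<and> norm (z - c) \<le> r" for z
    using r by (auto simp: U dist_norm norm_minus_commute)
  have dist: "dist (\<sigma> z) (\<sigma> w) = r\<^sup>2 * dist z w / (norm (z - c) * norm (w - c))"
    if "z \<noteq> c" "w \<noteq> c" for z w
  proof -
    have "\<sigma> z - \<sigma> w = of_real (r\<^sup>2) * (cnj (w - z)) / (cnj (z - c) * cnj (w - c))"
      using that unfolding \<sigma>_def by (simp add: field_simps)
    then have "norm (\<sigma> z - \<sigma> w) = norm (of_real (r\<^sup>2) * (cnj (w - z)) / (cnj (z - c) * cnj (w - c)))"
      by simp
    also have "\<dots> = r\<^sup>2 * norm (w - z) / (norm (z - c) * norm (w - c))"
      by (simp add: norm_mult norm_divide norm_power flip: complex_cnj_diff)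
    finally show ?thesis by (simp add: dist_norm norm_minus_commute)
  qed
  \<comment> \<open>The distortion factor \<open>r\<^sup>2 / (norm (z - c) * norm (w - c))\<close>
    lies between 1 and 4 when both norms lie between r/2 and r. This is the origin of the constant
    4.\<close>
  have bounds: "dist z w \<le> dist (\<sigma> z) (\<sigma> w)" "dist (\<sigma> z) (\<sigma> w) \<le> 4 * dist z w"
    if "z \<in> closure U - cball c (r/2)" "w \<in> closure U - cball c (r/2)" for z w
  proof -
    have n: "r / 2 < norm (z - c)" "norm (z - c) \<le> r" "r / 2 < norm (w - c)" "norm (w - c) \<le> r"
      using that unfolding cl by auto
    let ?p = "norm (z - c) * norm (w - c)"
    have p: "r / 2 * (r / 2) \<le> ?p" "?p \<le> r * r" "0 < ?p"
      using n r by (intro mult_mono mult_pos_pos; linarith)+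
    have "dist (\<sigma> z) (\<sigma> w) = r\<^sup>2 * dist z w / ?p"
      using n r by (intro dist) auto
    moreover have "dist z w * ?p \<le> dist z w * r\<^sup>2" "dist z w * r\<^sup>2 \<le> dist z w * (4 * ?p)"
      using p by (intro mult_left_mono; simp add: power2_eq_square)+
    ultimately show "dist z w \<le> dist (\<sigma> z) (\<sigma> w)" "dist (\<sigma> z) (\<sigma> w) \<le> 4 * dist z w"
      using p(3) by (auto simp: pos_le_divide_eq pos_divide_le_eq mult_ac)
  qed
  show ?thesis
  proof (rule that[of "cball c (r/2)" \<sigma>])
    show "cball c (r/2) \<subseteq> U" using r by (auto simp: U)
    show "\<sigma> z \<notin> U" if "z \<in> closure U - cball c (r/2)" for z
    proof -
      have n: "0 < norm (z - c)" "norm (z - c) \<le> r" using that r unfolding cl by auto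
      have "norm (\<sigma> z - c) = r\<^sup>2 / norm (z - c)"
        by (simp add: \<sigma>_def norm_divide norm_power flip: complex_cnj_diff)
      also have "\<dots> \<ge> r"
        using n r by (simp add: pos_le_divide_eq power2_eq_square)
      finally show ?thesis by (simp add: U dist_norm norm_minus_commute)
    qed
    show "\<sigma> z = z" if "z \<in> closure U - U" for z
    proof -
      have "norm (z - c) = r" using that r by (simp add: U dist_norm norm_minus_commute)
      then have "of_real (r\<^sup>2) = (z - c) * cnj (z - c)" "z \<noteq> c"
        using r complex_norm_square[of "z - c"] by auto
      then show ?thesis by (simp add: \<sigma>_def)
    qed
    show "4-lipschitz_on (closure U - cball c (r/2)) \<sigma>"
      by (intro lipschitz_onI bounds) auto
    show "dist z w \<le> 4 * dist (\<sigma> z) (\<sigma> w)"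
      if "z \<in> closure U - cball c (r/2)" "w \<in> closure U - cball c (r/2)" for z w
      using bounds(1)[OF that] zero_le_dist[of "\<sigma> z" "\<sigma> w"] by linarith
  qed simp
next
  fix a :: complex and b :: real assume a: "a \<noteq> 0" and U: "U = {z. a \<bullet> z < b}"
  \<comment> \<open>Reflection in a line is an isometry without a singular point, so N is empty in
    this case.\<close>
  define \<sigma> where "\<sigma> z = z - (2 * (a \<bullet> z - b) / (a \<bullet> a)) *\<^sub>R a" for z
  have cl: "closure U = {z. a \<bullet> z \<le> b}" unfolding U using a by (rule closure_halfspace_lt)
  have dist: "dist (\<sigma> z) (\<sigma> w) = dist z w" for z w
  proof -
    define v where "v = z - w"
    have "\<sigma> z - \<sigma> w = v - (2 * (a \<bullet> v) / (a \<bullet> a)) *\<^sub>R a"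
      unfolding \<sigma>_def v_def by (simp add: algebra_simps inner_diff_right diff_divide_distrib)
    moreover have "(v - (2 * (a \<bullet> v) / (a \<bullet> a)) *\<^sub>R a) \<bullet> (v - (2 * (a \<bullet> v) / (a \<bullet> a)) *\<^sub>R a) = v \<bullet> v"
      using a by (simp add: inner_diff_left inner_diff_right inner_commute[of v a] field_simps)
    ultimately show ?thesis by (simp add: dist_norm norm_eq_sqrt_inner v_def)
  qed
  have refl: "a \<bullet> \<sigma> z = 2 * b - a \<bullet> z" for z
    using a by (simp add: \<sigma>_def inner_diff_right field_simps)
  show ?thesis
  proof (rule that[of "{}" \<sigma>])
    show "\<sigma> z \<notin> U" if "z \<in> closure U - {}" for z
      using that refl[of z] by (simp add: cl) (simp add: U)
    show "\<sigma> z = z" if "z \<in> closure U - U" for z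
    proof -
      have "a \<bullet> z = b" using that by (simp add: cl) (simp add: U)
      then show ?thesis by (simp add: \<sigma>_def)
    qed
    show "4-lipschitz_on (closure U - {}) \<sigma>"
      by (intro lipschitz_onI) (simp_all add: dist)
    show "dist z w \<le> 4 * dist (\<sigma> z) (\<sigma> w)" for z w by (simp add: dist)
  qed simp_all
qed

section \<open>The cusp domain\<close>

lemma topspace_extended_plane [simp]: "topspace extended_plane = UNIV"
  by (simp add: extended_plane_def UNIV_option_conv)

lemma openin_extended_plane:
  "openin extended_plane T \<longleftrightarrow>
    (\<exists>V. open V \<and> T = Some ` V) \<or> (\<exists>C. compact C \<and> T = insert None (Some ` (- C)))"
  by (auto simp: extended_plane_def openin_Alexandroff_compactification Compl_eq_Diff_UNIV
      compact_imp_closed)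

lemma openin_extended_plane_Some: "openin extended_plane (Some ` V) \<longleftrightarrow> open V"
  by (simp add: extended_plane_def)

lemma continuous_map_Some_extended_plane: "continuous_map euclidean extended_plane Some"
  unfolding extended_plane_def by (rule continuous_map_Some)

lemma open_Collect_Some:
  assumes "openin extended_plane T"
  shows "open {z. Some z \<in> T}"
  using openin_continuous_map_preimage[OF continuous_map_Some_extended_plane assms] by simp

text \<open>Allows maps that avoid infinity to be treated as maps into the plane: h on the compact
  set N, its inverse far out, and the image curves.\<close>

lemma continuous_map_the:
  assumes "continuous_map X extended_plane g" "\<And>x. x \<in> topspace X \<Longrightarrow> g x \<noteq> None"
  shows "continuous_map X euclidean (the \<circ> g)"
  unfolding continuous_map
proof (intro conjI allI impI)
  fix V :: "complex set" assume "openin euclidean V"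
  then have "openin X {x \<in> topspace X. g x \<in> Some ` V}"
    by (intro openin_continuous_map_preimage[OF assms(1)]) (simp add: openin_extended_plane_Some)
  also have "{x \<in> topspace X. g x \<in> Some ` V} = {x \<in> topspace X. (the \<circ> g) x \<in> V}"
    using assms(2) by force
  finally show "openin X {x \<in> topspace X. (the \<circ> g) x \<in> V}" .
qed simp

lemma frontier_of_extended_plane_unbounded:
  assumes "open D" "\<not> bounded D"
  shows "extended_plane frontier_of (Some ` D) = insert None (Some ` frontier D)"
proof -
  have "x \<in> extended_plane closure_of (Some ` D) \<longleftrightarrow> x \<in> insert None (Some ` closure D)" for x
  proof (cases x)
    case None
    have "\<exists>y\<in>Some ` D. y \<in> T" if T: "openin extended_plane T" "None \<in> T" for T
    proof -
      obtain C where C: "compact C" "T = insert None (Some ` (- C))"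
        using T by (auto simp: openin_extended_plane)
      then have "\<not> D \<subseteq> C" using assms(2) bounded_subset compact_imp_bounded by blast
      then show ?thesis using C by auto
    qed
    then have "None \<in> extended_plane closure_of (Some ` D)"
      unfolding in_closure_of by auto
    then show ?thesis using None by simp
  next
    case (Some z)
    show ?thesis
    proof
      assume x: "x \<in> extended_plane closure_of (Some ` D)"
      have "D \<inter> V \<noteq> {}" if "open V" "z \<in> V" for V
      proof -
        have "\<exists>y. y \<in> Some ` D \<and> y \<in> Some ` V"
          using x that Some openin_extended_plane_Some[of V] unfolding in_closure_of by blast
        then show ?thesis by auto
      qed
      then have "z \<in> closure D"
        unfolding closure_iff_nhds_not_empty by blast
      then show "x \<in> insert None (Some ` closure D)" using Some by simp
    next
      assume "x \<in> insert None (Some ` closure D)"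
      then have z: "z \<in> closure D" using Some by auto
      have "\<exists>y\<in>Some ` D. y \<in> T" if T: "openin extended_plane T" "Some z \<in> T" for T
      proof -
        have "D \<inter> {z. Some z \<in> T} \<noteq> {}"
          using z T(2) open_Collect_Some[OF T(1)] unfolding closure_iff_nhds_not_empty by blast
        then show ?thesis by auto
      qed
      then have "Some z \<in> extended_plane closure_of (Some ` D)"
        unfolding in_closure_of by auto
      then show "x \<in> extended_plane closure_of (Some ` D)" using Some by simp
    qed
  qed
  then have "extended_plane closure_of (Some ` D) = insert None (Some ` closure D)" by blast
  moreover have "extended_plane interior_of (Some ` D) = Some ` D"
    using assms(1) by (simp add: interior_of_openin openin_extended_plane_Some)
  ultimately show ?thesis
    using assms(1) by (auto simp: frontier_of_def frontier_def interior_open)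
qed

text \<open>Since \<open>Re (exp w) = exp (Re w) * cos (Im w)\<close>, the boundary is the graph Re
  w = - ln (cos (Im w)) over |Im w| < pi/2, whose two ends are asymptotic to the lines |Im w| =
  pi/2. The second condition is Re (1 + z) > 1 for exp w = 1 + z.\<close>

definition cusp_domain :: "complex set"
  where "cusp_domain = {w. \<bar>Im w\<bar> < pi / 2 \<and> 1 < Re (exp w)}"

lemma open_cusp_domain: "open cusp_domain"
  unfolding cusp_domain_def by (intro open_Collect_conj open_Collect_less continuous_intros)

lemma Ln_image_right_half_plane: "(\<lambda>z. Ln (1 + z)) ` right_half_plane = cusp_domain"
proof (intro equalityI subsetI)
  fix w assume "w \<in> (\<lambda>z. Ln (1 + z)) ` right_half_plane"
  then obtain z where z: "0 < Re z" "w = Ln (1 + z)" by (auto simp: right_half_plane_def)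
  then have "1 + z \<noteq> 0" "0 < Re (1 + z)" by (auto simp: complex_eq_iff)
  then show "w \<in> cusp_domain"
    using z Re_Ln_pos_lt[of "1 + z"] by (simp add: cusp_domain_def)
next
  fix w assume "w \<in> cusp_domain"
  then have "Ln (1 + (exp w - 1)) = w" "exp w - 1 \<in> right_half_plane"
    by (auto simp: cusp_domain_def right_half_plane_def intro!: Ln_exp)
  then show "w \<in> (\<lambda>z. Ln (1 + z)) ` right_half_plane" by (metis imageI)
qed

lemma conformal_Ln: "conformal_mapping_on right_half_plane (\<lambda>z. Ln (1 + z))"
proof -
  have ne: "1 + z \<notin> \<real>\<^sub>\<le>\<^sub>0" if "z \<in> right_half_plane" for z
    using that by (auto simp: right_half_plane_def complex_nonpos_Reals_iff)
  then have "1 + z \<noteq> 0" if "z \<in> right_half_plane" for z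
    using that by force
  then have "inj_on (\<lambda>z. Ln (1 + z)) right_half_plane"
    by (auto simp: inj_on_def dest: arg_cong[where f = exp])
  with ne show ?thesis
    unfolding conformal_mapping_on_def by (intro conjI holomorphic_intros) auto
qed

lemma of_real_in_cusp_domain: "of_real x \<in> cusp_domain \<longleftrightarrow> 0 < x"
  by (simp add: cusp_domain_def exp_of_real)

lemma unbounded_cusp_domain: "\<not> bounded cusp_domain"
proof
  assume "bounded cusp_domain"
  then obtain B where B: "\<And>z. z \<in> cusp_domain \<Longrightarrow> norm z \<le> B" by (auto simp: bounded_iff)
  have "\<bar>B\<bar> + 1 \<le> B"
    using B[of "of_real (\<bar>B\<bar> + 1)"] by (simp add: of_real_in_cusp_domain del: of_real_add)
  then show False by simp
qed

lemma frontier_cusp_domain: "frontier cusp_domain = {w. \<bar>Im w\<bar> < pi / 2 \<and> Re (exp w) = 1}"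
proof (intro equalityI subsetI)
  let ?K = "{w. \<bar>Im w\<bar> \<le> pi / 2 \<and> 1 \<le> Re (exp w)}"
  have "closed ?K"
    by (intro closed_Collect_conj closed_Collect_le continuous_intros)
  then have cl: "closure cusp_domain \<subseteq> ?K"
    by (intro closure_minimal) (auto simp: cusp_domain_def)
  fix w assume "w \<in> frontier cusp_domain"
  then have w: "w \<in> ?K" "w \<notin> cusp_domain"
    using cl open_cusp_domain by (auto simp: frontier_def interior_open)
  \<comment> \<open>On the two horizontal lines the cosine vanishes, so \<open>Re (exp w)\<close> is
    0 instead of at least 1.\<close>
  have "\<bar>Im w\<bar> \<noteq> pi / 2"
  proof
    assume "\<bar>Im w\<bar> = pi / 2"
    then have "cos (Im w) = 0" by (metis cos_abs_real cos_pi_half)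
    then show False using w by (simp add: Re_exp)
  qed
  with w show "w \<in> {w. \<bar>Im w\<bar> < pi / 2 \<and> Re (exp w) = 1}" by (auto simp: cusp_domain_def)
next
  fix w assume "w \<in> {w. \<bar>Im w\<bar> < pi / 2 \<and> Re (exp w) = 1}"
  then have w: "\<bar>Im w\<bar> < pi / 2" "Re (exp w) = 1" by auto
  have "w \<in> closure cusp_domain"
    unfolding closure_approachable
  proof (intro allI impI)
    fix e :: real assume "0 < e"
    \<comment> \<open>A shift to the right by e/2 multiplies \<open>Re (exp w)\<close> by a factor
      above 1 and so leads from the curve into the domain.\<close>
    have "Re (exp (w + of_real (e/2))) = exp (e/2)"
      using w by (simp add: exp_add exp_of_real del: of_real_divide)
    then have "w + of_real (e/2) \<in> cusp_domain"
      using w \<open>0 < e\<close> by (simp add: cusp_domain_def del: of_real_divide)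
    moreover have "dist (w + of_real (e/2)) w < e"
      using \<open>0 < e\<close> by (simp add: dist_norm del: of_real_divide)
    ultimately show "\<exists>y\<in>cusp_domain. dist y w < e" by blast
  qed
  with w show "w \<in> frontier cusp_domain"
    using open_cusp_domain by (auto simp: frontier_def interior_open cusp_domain_def)
qed

text \<open>The circle is mapped by a Moebius map followed by the logarithm, with 1 going to
  infinity. Away from 1 continuity is that of \<open>Ln\<close>; at 1 it means that points mapped
  into a fixed compact set stay away from 1.\<close>

lemma jordan_curve_cusp_frontier: "jordan_curve (insert None (Some ` frontier cusp_domain))"
proof -
  define \<phi> where "\<phi> w = Ln (2 / (1 - w))" for w :: complex
  \<comment> \<open>\<open>w \<mapsto> 2 / (1 - w)\<close> maps the unit circle onto the line of real part 1\<close>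
  define g where "g w = (if w = 1 then None else Some (\<phi> w))" for w :: complex
  have Re1: "Re (2 / (1 - w)) = 1" if "norm w = 1" "w \<noteq> 1" for w :: complex
  proof -
    have "(Re w)\<^sup>2 + (Im w)\<^sup>2 = 1" using that(1) by (simp add: cmod_def)
    then have "(1 - Re w)\<^sup>2 + (Im w)\<^sup>2 = 2 * (1 - Re w)" by (simp add: power2_eq_square algebra_simps)
    moreover have "Re w \<noteq> 1"
      using that \<open>(Re w)\<^sup>2 + (Im w)\<^sup>2 = 1\<close> by (auto simp: complex_eq_iff)
    ultimately show ?thesis by (simp add: Re_divide)
  qed
  have exp_phi: "exp (\<phi> w) = 2 / (1 - w)" if "w \<noteq> 1" for w
    using that by (simp add: \<phi>_def)
  have cont: "continuous_on S \<phi>" if "S \<subseteq> sphere 0 1 - {1}" for S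
  proof -
    have "2 / (1 - w) \<notin> \<real>\<^sub>\<le>\<^sub>0" if "w \<in> S" for w
    proof -
      have "norm w = 1" "w \<noteq> 1" using that \<open>S \<subseteq> _\<close> by auto
      from Re1[OF this] show ?thesis by (auto simp: complex_nonpos_Reals_iff)
    qed
    then show ?thesis
      unfolding \<phi>_def using that by (intro continuous_intros) auto
  qed
  have "continuous_map (top_of_set (sphere 0 1)) extended_plane g"
    unfolding continuous_map
  proof (intro conjI allI impI)
    fix T assume "openin extended_plane T"
    then consider (finite) V where "open V" "T = Some ` V"
      | (infinite) C where "compact C" "T = insert None (Some ` (- C))"
      by (auto simp: openin_extended_plane)
    then show "openin (top_of_set (sphere 0 1)) {w \<in> topspace (top_of_set (sphere 0 1)). g w \<in> T}"
    proof cases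
      case finite
      have "openin (top_of_set (sphere 0 1 - {1})) ((sphere 0 1 - {1}) \<inter> \<phi> -` V)"
        using finite(1) by (intro continuous_openin_preimage_gen cont) auto
      moreover have "openin (top_of_set (sphere 0 1)) (sphere 0 1 - {1})"
        by (simp add: openin_delete)
      ultimately have "openin (top_of_set (sphere 0 1)) ((sphere 0 1 - {1}) \<inter> \<phi> -` V)"
        by (rule openin_trans)
      also have "(sphere 0 1 - {1}) \<inter> \<phi> -` V = {w \<in> topspace (top_of_set (sphere 0 1)). g w \<in> T}"
        by (auto simp: g_def finite(2))
      finally show ?thesis .
    next
      case infinite
      obtain B where B: "\<And>z. z \<in> C \<Longrightarrow> norm z \<le> B"
        using compact_imp_bounded[OF infinite(1)] by (auto simp: bounded_iff)
      \<comment> \<open>If the image of w lies in C, then norm (2 / (1 - w)) is at most exp B, so w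
        lies in this closed part of the circle, which omits 1.\<close>
      define K :: "complex set" where "K = sphere 0 1 \<inter> {w. 2 * exp (- B) \<le> norm (1 - w)}"
      have "closed K"
        unfolding K_def by (intro closed_Int closed_Collect_le continuous_intros) auto
      moreover have K1: "K \<subseteq> sphere 0 1 - {1}" by (auto simp: K_def)
      ultimately have cl: "closed (K \<inter> \<phi> -` C)"
        using infinite(1) by (intro continuous_closed_preimage cont) (auto simp: compact_imp_closed)
      have "w \<in> K" if "w \<in> sphere 0 1" "w \<noteq> 1" "\<phi> w \<in> C" for w
      proof -
        have "2 / norm (1 - w) = norm (exp (\<phi> w))"
          using exp_phi[OF that(2)] by (simp add: norm_divide)
        also have "\<dots> \<le> exp B"
          using B[OF that(3)] abs_Re_le_cmod[of "\<phi> w"] by simp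
        finally show ?thesis
          using that by (simp add: K_def exp_minus field_simps)
      qed
      then have "{w \<in> topspace (top_of_set (sphere 0 1)). g w \<in> T} = sphere 0 1 - K \<inter> \<phi> -` C"
        using K1 by (auto simp: g_def infinite(2))
      moreover have "openin (top_of_set (sphere 0 1)) (sphere 0 1 - K \<inter> \<phi> -` C)"
        using cl by (metis Diff_eq open_Compl openin_open_Int)
      ultimately show ?thesis by simp
    qed
  qed simp
  moreover have "inj_on g (sphere 0 1)"
  proof (rule inj_onI)
    fix v w assume "g v = g w"
    then have "v = 1 \<and> w = 1 \<or> v \<noteq> 1 \<and> w \<noteq> 1 \<and> exp (\<phi> v) = exp (\<phi> w)"
      by (auto simp: g_def split: if_splits)
    moreover have "u = 1 - 2 / exp (\<phi> u)" if "u \<noteq> 1" for u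
      using exp_phi[OF that] that by (simp add: diff_divide_distrib)
    ultimately show "v = w" by metis
  qed
  moreover have "insert None (Some ` frontier cusp_domain) = g ` sphere 0 1"
  proof (intro equalityI subsetI)
    fix x assume "x \<in> insert None (Some ` frontier cusp_domain)"
    then consider "x = None" | v where "x = Some v" "\<bar>Im v\<bar> < pi / 2" "Re (exp v) = 1"
      by (auto simp: frontier_cusp_domain)
    then show "x \<in> g ` sphere 0 1"
    proof cases
      case 1
      then show ?thesis by (auto simp: g_def intro!: image_eqI[of _ _ 1])
    next
      case (2 v)
      define w where "w = 1 - 2 / exp v"
      \<comment> \<open>On the line of real part 1, subtracting 2 agrees with the reflection u to -
        cnj u and preserves the modulus, which puts w on the unit circle.\<close>
      have "exp v - 2 = - cnj (exp v)" using 2(3) by (simp add: complex_eq_iff)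
      then have "norm (exp v - 2) = norm (exp v)" by (metis complex_mod_cnj norm_minus_cancel)
      moreover have "w = (exp v - 2) / exp v" by (simp add: w_def field_simps)
      ultimately have "w \<in> sphere 0 1" by (simp add: norm_divide)
      moreover have "w \<noteq> 1" "2 / (1 - w) = exp v" by (auto simp: w_def)
      then have "g w = x"
        using 2 Ln_exp[of v] by (simp add: g_def \<phi>_def)
      ultimately show ?thesis by blast
    qed
  next
    fix x assume "x \<in> g ` sphere 0 1"
    then obtain w where w: "norm w = 1" "x = g w" by auto
    have "\<phi> w \<in> frontier cusp_domain" if "w \<noteq> 1"
      using Re1[OF w(1) that] exp_phi[OF that] Re_Ln_pos_lt[of "2 / (1 - w)"] that
      by (simp add: frontier_cusp_domain \<phi>_def[symmetric])
    then show "x \<in> insert None (Some ` frontier cusp_domain)" using w by (simp add: g_def)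
  qed
  ultimately show ?thesis unfolding jordan_curve_def by blast
qed

lemma jordan_domain_cusp: "jordan_domain (Some ` cusp_domain)"
  unfolding jordan_domain_def
proof (intro conjI)
  show "Some ` cusp_domain \<noteq> {}" using of_real_in_cusp_domain[of 1] by auto
  show "openin extended_plane (Some ` cusp_domain)"
    by (simp add: openin_extended_plane_Some open_cusp_domain)
  have "continuous_on right_half_plane (\<lambda>z. Ln (1 + z))"
    using conformal_Ln by (auto simp: conformal_mapping_on_def intro: holomorphic_on_imp_continuous_on)
  moreover have "connected right_half_plane"
    unfolding right_half_plane_def by (intro convex_connected convex_halfspace_Re_gt)
  ultimately have "connected cusp_domain"
    unfolding Ln_image_right_half_plane[symmetric] by (rule connected_continuous_image)
  then show "connectedin extended_plane (Some ` cusp_domain)"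
    by (intro connectedin_continuous_map_image[OF continuous_map_Some_extended_plane]) simp
  show "jordan_curve (extended_plane frontier_of (Some ` cusp_domain))"
    using jordan_curve_cusp_frontier
    by (simp add: frontier_of_extended_plane_unbounded open_cusp_domain unbounded_cusp_domain)
qed

section \<open>The Schwarzian derivative of the logarithm\<close>

lemma schwarzian_Ln:
  assumes "0 < Re z"
  shows "schwarzian (\<lambda>z. Ln (1 + z)) z = 1 / (2 * (1 + z)\<^sup>2)"
proof -
  let ?H = "{z :: complex. 0 < Re z}" and ?f = "\<lambda>z. Ln (1 + z)"
  have opn: "open ?H" by (rule open_halfspace_Re_gt)
  have ne: "1 + z \<noteq> 0" "1 + z \<notin> \<real>\<^sub>\<le>\<^sub>0" if "z \<in> ?H" for z
    using that by (auto simp: complex_nonpos_Reals_iff complex_eq_iff)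
  \<comment> \<open>Each formula is proved on the whole open half-plane, because differentiating it
    once more requires it on a neighbourhood.\<close>
  have d1: "deriv ?f z = inverse (1 + z)" if "z \<in> ?H" for z
    by (rule DERIV_imp_deriv) (use ne[OF that] in \<open>auto intro!: derivative_eq_intros simp: field_simps\<close>)
  have inv: "((\<lambda>z. inverse (1 + z)) has_field_derivative - inverse ((1 + z)\<^sup>2)) (at z)" if "z \<in> ?H" for z
    using ne[OF that] by (auto intro!: derivative_eq_intros simp: power2_eq_square)
  have d2: "deriv (deriv ?f) z = - inverse ((1 + z)\<^sup>2)" if "z \<in> ?H" for z
    by (intro DERIV_imp_deriv has_field_derivative_transform_within_open[OF inv[OF that] opn that])
       (simp add: d1)
  have pre: "pre_schwarzian ?f z = - inverse (1 + z)" if "z \<in> ?H" for z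
    using ne[OF that] by (simp add: pre_schwarzian_def d1[OF that] d2[OF that] power2_eq_square)
  have "z \<in> ?H" using assms by simp
  have "deriv (pre_schwarzian ?f) z = inverse ((1 + z)\<^sup>2)"
    by (intro DERIV_imp_deriv has_field_derivative_transform_within_open
        [OF DERIV_minus[OF inv[OF \<open>z \<in> ?H\<close>], simplified] opn \<open>z \<in> ?H\<close>]) (simp add: pre)
  then have "schwarzian ?f z = inverse ((1 + z)\<^sup>2) - (- inverse (1 + z))\<^sup>2 / 2"
    by (simp only: schwarzian_def pre[OF \<open>z \<in> ?H\<close>])
  then show ?thesis by (simp add: power_divide divide_simps)
qed

text \<open>In the half-plane \<open>norm (1 + z)\<close> is at least 1, so the Schwarzian has
  modulus at most 1/2 whatever Im z is, and the weight alone forces the limit.\<close>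

lemma schwarzian_Ln_limit:
  "((\<lambda>t::real. SUP z\<in>{z. 0 < Re z \<and> Re z \<le> t}.
      ereal ((2 * Re z)\<^sup>2 * norm (schwarzian (\<lambda>z. Ln (1 + z)) z))) \<longlongrightarrow> 0) (at_right 0)"
proof (rule tendsto_sandwich)
  let ?s = "\<lambda>z. (2 * Re z)\<^sup>2 * norm (schwarzian (\<lambda>z. Ln (1 + z)) z)"
  have upper: "?s z \<le> 2 * t\<^sup>2" if "0 < Re z" "Re z \<le> t" for z t
  proof -
    have "1 \<le> norm (1 + z)" using complex_Re_le_cmod[of "1 + z"] that by simp
    then have "1 \<le> (norm (1 + z))\<^sup>2" by simp
    then have "norm (schwarzian (\<lambda>z. Ln (1 + z)) z) \<le> 1 / 2"
      using that by (simp add: schwarzian_Ln norm_divide norm_mult norm_power divide_simps)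
    then have "?s z \<le> (2 * t)\<^sup>2 * (1 / 2)"
      using that by (intro mult_mono power_mono) auto
    then show ?thesis by simp
  qed
  show "\<forall>\<^sub>F t in at_right 0. 0 \<le> (SUP z\<in>{z. 0 < Re z \<and> Re z \<le> t}. ereal (?s z))"
    unfolding eventually_at_right_field
  proof (intro exI[of _ 1] conjI allI impI)
    fix t :: real assume "0 < t"
    \<comment> \<open>The point t shows that the index set is nonempty; an empty supremum in
      \<open>ereal\<close> would be minus infinity.\<close>
    then show "0 \<le> (SUP z\<in>{z. 0 < Re z \<and> Re z \<le> t}. ereal (?s z))"
      by (intro SUP_upper2[of "of_real t"]) auto
  qed simp
  show "\<forall>\<^sub>F t in at_right 0. (SUP z\<in>{z. 0 < Re z \<and> Re z \<le> t}. ereal (?s z)) \<le> ereal (2 * t\<^sup>2)"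
    by (intro always_eventually allI SUP_least) (use upper in auto)
  have "((\<lambda>t::real. 2 * t\<^sup>2) \<longlongrightarrow> 2 * 0\<^sup>2) (at_right 0)"
    by (intro tendsto_intros)
  then show "((\<lambda>t. ereal (2 * t\<^sup>2)) \<longlongrightarrow> 0) (at_right 0)"
    by (simp add: zero_ereal_def)
qed simp

section \<open>Crosscuts and the failure of the quasidisk property\<close>

lemma crosscut:
  assumes "0 < x" and a: "a = arccos (exp (- x))"
  shows "0 < a" "a < pi / 2"
    and "0 < t \<Longrightarrow> t < 1 \<Longrightarrow> Complex x (a * (1 - 2 * t)) \<in> cusp_domain"
    and "t = 0 \<or> t = 1 \<Longrightarrow> Complex x (a * (1 - 2 * t)) \<in> frontier cusp_domain"
proof -
  have e: "0 < exp (- x)" "exp (- x) < 1" using assms(1) by auto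
  show a0: "0 < a" using arccos_lt_bounded[of "exp (- x)"] e unfolding a by linarith
  \<comment> \<open>\<open>exp x * cos a = 1\<close> puts the points of height a and - a over x on
    the boundary curve.\<close>
  have cosa: "cos a = exp (- x)" unfolding a using e by (intro cos_arccos; linarith)
  have "a \<noteq> pi / 2" using cosa e(1) cos_pi_half by (metis order_less_irrefl)
  moreover have "a \<le> pi / 2" unfolding a using e by (intro arccos_le_pi2; linarith)
  ultimately show a1: "a < pi / 2" by simp
  have Re: "Re (exp (Complex x y)) = exp x * cos y" for y by (simp add: Re_exp)
  show "Complex x (a * (1 - 2 * t)) \<in> cusp_domain" if "0 < t" "t < 1"
  proof -
    have "\<bar>1 - 2 * t\<bar> < 1" using that by auto
    then have lt: "\<bar>a * (1 - 2 * t)\<bar> < a"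
      using a0 by (simp add: abs_mult)
    then have "cos a < cos \<bar>a * (1 - 2 * t)\<bar>"
      using a1 by (intro cos_monotone_0_pi) auto
    then have "exp x * exp (- x) < exp x * cos (a * (1 - 2 * t))"
      by (simp add: cosa del: abs_mult)
    then show ?thesis
      using lt a1 by (simp add: cusp_domain_def Re exp_minus)
  qed
  show "Complex x (a * (1 - 2 * t)) \<in> frontier cusp_domain" if "t = 0 \<or> t = 1"
    using that a0 a1 cosa by (auto simp: frontier_cusp_domain Re exp_minus)
qed

lemma closure_cusp_domain_Im: "w \<in> closure cusp_domain \<Longrightarrow> \<bar>Im w\<bar> \<le> pi / 2"
  using closure_Un_frontier[of cusp_domain] frontier_cusp_domain
  by (auto simp: cusp_domain_def)

lemma not_quasidisk_cusp: "\<not> quasidisk (Some ` cusp_domain)"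
proof
  assume "quasidisk (Some ` cusp_domain)"
  then obtain h U where qc: "quasiconformal h" and U: "disk_or_half_plane U"
    and hU: "Some ` cusp_domain = h ` Some ` U"
    unfolding quasidisk_def by auto
  obtain K where hom: "homeomorphic_map extended_plane extended_plane h" and "1 \<le> K"
    and K: "\<And>\<Gamma>. (\<And>\<gamma>. \<gamma> \<in> \<Gamma> \<Longrightarrow> nonconstant_curve \<gamma>) \<Longrightarrow>
      curve_modulus ((\<lambda>\<gamma>. h \<circ> \<gamma>) ` \<Gamma>) \<le> ennreal K * curve_modulus \<Gamma> \<and>
      curve_modulus \<Gamma> \<le> ennreal K * curve_modulus ((\<lambda>\<gamma>. h \<circ> \<gamma>) ` \<Gamma>)"
    using qc unfolding quasiconformal_def by blast
  obtain k where h: "continuous_map extended_plane extended_plane h"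
    and k: "continuous_map extended_plane extended_plane k"
    and kh: "\<And>x. k (h x) = x" and hk: "\<And>x. h (k x) = x"
    using hom unfolding homeomorphic_map_maps homeomorphic_maps_def by auto
  obtain \<sigma> N where N: "compact N" "N \<subseteq> U" and \<sigma>_out: "\<And>z. z \<in> closure U - N \<Longrightarrow> \<sigma> z \<notin> U"
    and \<sigma>_fix: "\<And>z. z \<in> closure U - U \<Longrightarrow> \<sigma> z = z" and \<sigma>: "4-lipschitz_on (closure U - N) \<sigma>"
    and \<sigma>_inv: "\<And>z w. z \<in> closure U - N \<Longrightarrow> w \<in> closure U - N \<Longrightarrow> dist z w \<le> 4 * dist (\<sigma> z) (\<sigma> w)"
    using disk_reflection[OF U] by metis
  have h_mem: "h (Some z) \<in> Some ` cusp_domain \<longleftrightarrow> z \<in> U" for z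
    unfolding hU using kh by (metis (no_types, lifting) imageE imageI option.inject)
  \<comment> \<open>The inverse of h read in the plane; it has this meaning where k avoids infinity,
    in particular for norms above \<open>M\<^sub>0\<close>.\<close>
  define \<kappa> where "\<kappa> w = the (k (Some w))" for w
  \<comment> \<open>N lies in U, so its image under h is a compact set in the plane, and infinity
    has at most one finite image. Should h fix infinity, \<open>the (h None)\<close> is an
    unspecified point, which does no harm to the bound.\<close>
  obtain M\<^sub>0 where M\<^sub>0: "\<And>w. M\<^sub>0 < norm w \<Longrightarrow> k (Some w) \<notin> insert None (Some ` N)"
  proof -
    have "continuous_map (top_of_set N) euclidean (the \<circ> (h \<circ> Some))"
    proof (rule continuous_map_the)
      show "continuous_map (top_of_set N) extended_plane (h \<circ> Some)"
        by (intro continuous_map_from_subtopology continuous_map_compose[OF _ h]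
            continuous_map_Some_extended_plane)
      show "(h \<circ> Some) z \<noteq> None" if "z \<in> topspace (top_of_set N)" for z
        using that N(2) h_mem[of z] by auto
    qed
    then have "compact ((the \<circ> (h \<circ> Some)) ` N)"
      using N(1) by (intro compact_continuous_image) auto
    then have "bounded (insert (the (h None)) ((the \<circ> (h \<circ> Some)) ` N))"
      by (simp add: compact_imp_bounded)
    then obtain B where B: "\<And>w. w \<in> insert (the (h None)) ((the \<circ> (h \<circ> Some)) ` N) \<Longrightarrow> norm w \<le> B"
      by (auto simp: bounded_iff)
    show ?thesis
    proof (rule that[of B], rule notI)
      fix w assume "B < norm w" and "k (Some w) \<in> insert None (Some ` N)"
      from imageI[OF this(2), of "the \<circ> h"]
      have "w \<in> insert (the (h None)) ((the \<circ> (h \<circ> Some)) ` N)"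
        by (auto simp: hk image_comp comp_assoc)
      with B \<open>B < norm w\<close> show False by (auto simp: not_le[symmetric])
    qed
  qed
  have \<kappa>: "k (Some w) = Some (\<kappa> w)" "\<kappa> w \<notin> N" "h (Some (\<kappa> w)) = Some w" if "M\<^sub>0 < norm w" for w
  proof -
    show "k (Some w) = Some (\<kappa> w)" using M\<^sub>0[OF that] by (auto simp: \<kappa>_def)
    then show "\<kappa> w \<notin> N" "h (Some (\<kappa> w)) = Some w"
      using M\<^sub>0[OF that] hk[of "Some w"] by auto
  qed
  have \<kappa>_U: "\<kappa> w \<in> U \<longleftrightarrow> w \<in> cusp_domain" if "M\<^sub>0 < norm w" for w
    using h_mem[of "\<kappa> w"] \<kappa>(3)[OF that] by auto
  have cont_\<kappa>: "continuous_on {w. M\<^sub>0 < norm w} \<kappa>"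
  proof -
    have "continuous_map (top_of_set {w. M\<^sub>0 < norm w}) euclidean (the \<circ> (k \<circ> Some))"
    proof (rule continuous_map_the)
      show "continuous_map (top_of_set {w. M\<^sub>0 < norm w}) extended_plane (k \<circ> Some)"
        by (intro continuous_map_from_subtopology continuous_map_compose[OF _ k]
            continuous_map_Some_extended_plane)
    qed (use \<kappa>(1) in auto)
    then show ?thesis by (simp add: \<kappa>_def[abs_def] comp_def)
  qed
  have \<kappa>_closure: "\<kappa> w \<in> closure U - N" if "w \<in> closure cusp_domain" "M\<^sub>0 < norm w" for w
  proof -
    obtain s where s: "\<And>n. s n \<in> cusp_domain" "s \<longlonglongrightarrow> w"
      using \<open>w \<in> closure cusp_domain\<close> by (auto simp: closure_sequential)
    have "open {w :: complex. M\<^sub>0 < norm w}" by (intro open_Collect_less continuous_intros)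
    then have "isCont \<kappa> w"
      using cont_\<kappa> that(2) by (simp add: continuous_on_eq_continuous_at)
    then have "(\<lambda>n. \<kappa> (s n)) \<longlonglongrightarrow> \<kappa> w" using s(2) by (rule isCont_tendsto_compose)
    moreover have "\<forall>\<^sub>F n in sequentially. M\<^sub>0 < norm (s n)"
      using tendsto_norm[OF s(2)] that(2) by (rule order_tendstoD)
    then have "\<forall>\<^sub>F n in sequentially. \<kappa> (s n) \<in> closure U"
      by eventually_elim (use s(1) \<kappa>_U closure_subset in blast)
    ultimately have "\<kappa> w \<in> closure U"
      by (intro Lim_in_closed_set[OF closed_closure]) auto
    with \<kappa>(2)[OF that(2)] show ?thesis by blast
  qed

  define B where "B = bilipschitz_const 4"
  \<comment> \<open>With 2 \<le> M the end points of the crosscuts have norm at most 2 M + pi/2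
    \<le> 3 M; \<open>M\<^sub>0 < M\<close> makes \<open>\<kappa>\<close> meaningful on the
    crosscuts; the last entry contradicts the final estimate.\<close>
  define M where "M = Max {2, M\<^sub>0 + 1, K * (B * (K * (pi * 16))) * pi + 1}"
  have M: "2 \<le> M" "M\<^sub>0 < M" "K * (B * (K * (pi * 16))) * pi < M"
    unfolding M_def by auto
  have "0 < B" by (simp add: B_def bilipschitz_const_pos)
  define a where "a x = arccos (exp (- x))" for x :: real
  define \<gamma> where "\<gamma> x t = Complex x (a x * (1 - 2 * t))" for x t
  have x0: "0 < x" if "x \<in> {M..2*M}" for x using that M(1) by auto
  note cc = crosscut[OF x0 a_def]
  have norm_\<gamma>: "M\<^sub>0 < norm (\<gamma> x t)" if "x \<in> {M..2*M}" for x t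
    using complex_Re_le_cmod[of "\<gamma> x t"] that M by (simp add: \<gamma>_def)
  have \<gamma>_ends: "\<gamma> x t \<in> closure cusp_domain" "\<gamma> x t \<notin> cusp_domain"
    if "x \<in> {M..2*M}" "t = 0 \<or> t = 1" for x t
    using cc(4)[OF that] open_cusp_domain unfolding \<gamma>_def frontier_def by (auto simp: interior_open)
  have \<gamma>_closure: "\<gamma> x t \<in> closure cusp_domain" if "x \<in> {M..2*M}" "t \<in> {0..1}" for x t
    using cc(3)[OF that(1), of t] \<gamma>_ends(1)[OF that(1), of t] that(2) closure_subset[of cusp_domain]
    unfolding \<gamma>_def[symmetric] by (cases "t = 0 \<or> t = 1") auto
  define \<beta> where "\<beta> x t = \<kappa> (\<gamma> x t)" for x t
  have cont_\<beta>: "continuous_on {0..1} (\<beta> x)" if "x \<in> {M..2*M}" for x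
    unfolding \<beta>_def
  proof (rule continuous_on_compose2[OF cont_\<kappa>])
    show "continuous_on {0..1} (\<gamma> x)" unfolding \<gamma>_def Complex_eq by (intro continuous_intros)
  qed (use norm_\<gamma>[OF that] in auto)
  have \<beta>_in: "\<beta> x t \<in> closure U - N" if "x \<in> {M..2*M}" "t \<in> {0..1}" for x t
    unfolding \<beta>_def by (intro \<kappa>_closure \<gamma>_closure norm_\<gamma> that)
  \<comment> \<open>End points of a crosscut lie in the closure of the domain but not in it, so
    their preimages lie on the boundary of U. The reflected curves thus keep their end
    points.\<close>
  have \<beta>_ends: "\<sigma> (\<beta> x t) = \<beta> x t" if "x \<in> {M..2*M}" "t = 0 \<or> t = 1" for x t
  proof (rule \<sigma>_fix)
    show "\<beta> x t \<in> closure U - U"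
      using \<beta>_in[OF that(1), of t] \<kappa>_U[OF norm_\<gamma>[OF that(1), of t]] \<gamma>_ends(2)[OF that] that(2)
      by (auto simp: \<beta>_def)
  qed
  have h\<beta>: "h (Some (\<beta> x t)) = Some (\<gamma> x t)" if "x \<in> {M..2*M}" for x t
    unfolding \<beta>_def by (intro \<kappa>(3) norm_\<gamma> that)
  \<comment> \<open>Quasi-invariance is granted for nonconstant curves only; distinct end points
    ensure this for the preimages and their reflections.\<close>
  have \<beta>_01: "\<beta> x 0 \<noteq> \<beta> x 1" if "x \<in> {M..2*M}" for x
  proof
    assume "\<beta> x 0 = \<beta> x 1"
    then have "\<gamma> x 0 = \<gamma> x 1" using h\<beta>[OF that, of 0] h\<beta>[OF that, of 1] by simp
    then show False using cc(1)[OF that] by (simp add: \<gamma>_def)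
  qed
  have cont_\<sigma>\<beta>: "continuous_on {0..1} (\<lambda>t. \<sigma> (\<beta> x t))" if "x \<in> {M..2*M}" for x
    using \<beta>_in[OF that]
    by (intro continuous_on_compose2[OF lipschitz_on_continuous_on[OF \<sigma>] cont_\<beta>[OF that]]) auto
  have pathin_Some: "pathin extended_plane (Some \<circ> g)" if "continuous_on {0..1} g" for g :: "real \<Rightarrow> complex"
    unfolding pathin_def using that
    by (intro continuous_map_compose[OF _ continuous_map_Some_extended_plane]) simp

  have nonconst: "nonconstant_curve (Some \<circ> g)"
    if "continuous_on {0..1} g" "g 0 \<noteq> g 1" for g :: "real \<Rightarrow> complex"
  proof -
    have "0 \<in> {0..1::real}" "1 \<in> {0..1::real}" "(Some \<circ> g) 0 \<noteq> (Some \<circ> g) 1"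
      using that(2) by auto
    with pathin_Some[OF that(1)] show ?thesis
      unfolding nonconstant_curve_def by blast
  qed

  \<comment> \<open>A compact set containing all the crosscuts. Its image under
    \<open>\<kappa>\<close> is the compact set demanded by the bilipschitz estimate;
    \<open>closure U - N\<close> itself may fail to be closed or bounded.\<close>
  define W where "W = closure cusp_domain \<inter> {w. M \<le> Re w \<and> Re w \<le> 2 * M}"
  define F where "F = \<beta> ` {M..2*M}"
  define \<Gamma>\<^sub>0 \<Gamma>\<^sub>1 \<Gamma>\<^sub>2 where "\<Gamma>\<^sub>0 = (\<lambda>x. Some \<circ> \<gamma> x) ` {M..2*M}"
    and "\<Gamma>\<^sub>1 = (\<lambda>\<beta>. Some \<circ> \<beta>) ` F" and "\<Gamma>\<^sub>2 = (\<lambda>\<beta>. Some \<circ> (\<sigma> \<circ> \<beta>)) ` F"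
  have W_norm: "M\<^sub>0 < norm w" if "w \<in> W" for w
    using that M complex_Re_le_cmod[of w] by (auto simp: W_def)
  have "compact (\<kappa> ` W)"
  proof (rule compact_continuous_image)
    show "continuous_on W \<kappa>"
      using W_norm by (intro continuous_on_subset[OF cont_\<kappa>]) auto
    have "closed W"
      unfolding W_def
      by (intro closed_Int closed_closure closed_Collect_conj closed_Collect_le continuous_intros)
    moreover have "norm w \<le> 2 * M + pi / 2" if "w \<in> W" for w
      using that closure_cusp_domain_Im[of w] cmod_le[of w] M by (auto simp: W_def)
    then have "bounded W" by (auto simp: bounded_iff)
    ultimately show "compact W" by (simp add: compact_eq_bounded_closed)
  qed
  have \<kappa>W: "\<kappa> ` W \<subseteq> closure U - N"
    using \<kappa>_closure W_norm by (auto simp: W_def)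

  \<comment> \<open>\<open>\<Gamma>\<^sub>0\<close> consists of the crosscuts,
    \<open>\<Gamma>\<^sub>1\<close> of their preimages and \<open>\<Gamma>\<^sub>2\<close> of the
    reflected preimages. A crosscut has length 2 a x \<le> pi, which explains the divisor.\<close>
  have "ennreal (M / pi) = ennreal ((2 * M - M) / pi)" by simp
  also have "\<dots> \<le> curve_modulus \<Gamma>\<^sub>0"
    unfolding \<Gamma>\<^sub>0_def \<gamma>_def
  proof (rule curve_modulus_vertical_segments_ge)
    show "0 < a x" "2 * a x \<le> pi" if "x \<in> {M..2*M}" for x using cc(1,2)[OF that] by auto
  qed (use M in auto)
  also have "\<Gamma>\<^sub>0 = (\<lambda>\<gamma>. h \<circ> \<gamma>) ` \<Gamma>\<^sub>1"
    unfolding \<Gamma>\<^sub>0_def \<Gamma>\<^sub>1_def F_def image_image by (intro image_cong) (auto simp: h\<beta>)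
  also have "curve_modulus \<dots> \<le> ennreal K * curve_modulus \<Gamma>\<^sub>1"
  proof (rule K[THEN conjunct1])
    fix \<eta> assume "\<eta> \<in> \<Gamma>\<^sub>1"
    then obtain x where x: "x \<in> {M..2*M}" "\<eta> = Some \<circ> \<beta> x" by (auto simp: \<Gamma>\<^sub>1_def F_def)
    then show "nonconstant_curve \<eta>"
      using nonconst[OF cont_\<beta>[OF x(1)] \<beta>_01[OF x(1)]] by simp
  qed
  also have "curve_modulus \<Gamma>\<^sub>1 \<le> ennreal B * curve_modulus \<Gamma>\<^sub>2"
    unfolding \<Gamma>\<^sub>1_def \<Gamma>\<^sub>2_def B_def
  proof (rule curve_modulus_bilipschitz_le[OF \<open>compact (\<kappa> ` W)\<close>])
    show "4-lipschitz_on (\<kappa> ` W) \<sigma>" using \<sigma> \<kappa>W by (rule lipschitz_on_subset)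
    show "dist z w \<le> 4 * dist (\<sigma> z) (\<sigma> w)" if "z \<in> \<kappa> ` W" "w \<in> \<kappa> ` W" for z w
      using \<sigma>_inv that \<kappa>W by blast
    fix b assume "b \<in> F"
    then obtain x where x: "x \<in> {M..2*M}" "b = \<beta> x" by (auto simp: F_def)
    show "continuous_on {0..1} b" using cont_\<beta> x by simp
    have "\<gamma> x t \<in> W" if "t \<in> {0..1}" for t
      using \<gamma>_closure[OF x(1) that] x(1) by (simp add: W_def) (simp add: \<gamma>_def)
    then show "b ` {0..1} \<subseteq> \<kappa> ` W" unfolding x(2) \<beta>_def by auto
  qed simp
  also have "curve_modulus \<Gamma>\<^sub>2 \<le> ennreal K * curve_modulus ((\<lambda>\<gamma>. h \<circ> \<gamma>) ` \<Gamma>\<^sub>2)"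
  proof (rule K[THEN conjunct2])
    fix \<eta> assume "\<eta> \<in> \<Gamma>\<^sub>2"
    then obtain x where x: "x \<in> {M..2*M}" "\<eta> = Some \<circ> (\<lambda>t. \<sigma> (\<beta> x t))"
      by (auto simp: \<Gamma>\<^sub>2_def F_def comp_def)
    then show "nonconstant_curve \<eta>"
      using nonconst[OF cont_\<sigma>\<beta>[OF x(1)]] \<beta>_01[OF x(1)] \<beta>_ends[OF x(1)] by simp
  qed
  \<comment> \<open>Starting points lie within R = 3 M of the origin and the curves get m = M away
    from them, so the bound is 16 pi for every M.\<close>
  also have "curve_modulus ((\<lambda>\<gamma>. h \<circ> \<gamma>) ` \<Gamma>\<^sub>2) \<le> ennreal (pi * ((3 * M + M) / M)\<^sup>2)"
  proof (rule curve_modulus_long_curves_le)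
    fix \<eta> assume "\<eta> \<in> (\<lambda>\<gamma>. h \<circ> \<gamma>) ` \<Gamma>\<^sub>2" and fin: "None \<notin> \<eta> ` {0..1}"
    then obtain x where x: "x \<in> {M..2*M}" and \<eta>: "\<eta> = h \<circ> (Some \<circ> (\<lambda>t. \<sigma> (\<beta> x t)))"
      by (auto simp: \<Gamma>\<^sub>2_def F_def comp_def)
    have ends: "\<eta> t = Some (\<gamma> x t)" if "t = 0 \<or> t = 1" for t
      using that h\<beta>[OF x, of t] \<beta>_ends[OF x that] by (simp add: \<eta>)
    show "the (\<eta> 0) \<in> cball 0 (3 * M)"
      using cmod_le[of "\<gamma> x 0"] cc(1,2)[OF x] x M pi_half_less_two by (simp add: ends) (simp add: \<gamma>_def)
    have "continuous_map (top_of_set {0..1}) euclidean (the \<circ> \<eta>)"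
    proof (rule continuous_map_the)
      show "continuous_map (top_of_set {0..1}) extended_plane \<eta>"
        using pathin_Some[OF cont_\<sigma>\<beta>[OF x]] unfolding \<eta> pathin_def
        by (rule continuous_map_compose[OF _ h])
    qed (use fin in force)
    then show cont: "continuous_on {0..1} (the \<circ> \<eta>)" by simp
    have "\<exists>t\<ge>0. t \<le> 1 \<and> Im ((the \<circ> \<eta>) t) = 0"
      using cc(1)[OF x]
      by (intro IVT2' continuous_on_Im cont) (simp_all add: ends \<gamma>_def)
    then obtain t where t: "t \<in> {0..1}" "Im (the (\<eta> t)) = 0" by auto
    \<comment> \<open>The reflection leaves U, so its image under h leaves the domain, which
      contains every positive real. A crossing of the real axis therefore has Re \<le> 0, at
      distance at least M from the starting point of abscissa x \<ge> M.\<close>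
    have "the (\<eta> t) \<notin> cusp_domain"
    proof
      assume "the (\<eta> t) \<in> cusp_domain"
      then have "\<eta> t \<in> Some ` cusp_domain" using fin t(1) by (metis imageI option.collapse)
      then show False using \<sigma>_out[OF \<beta>_in[OF x t(1)]] h_mem by (simp add: \<eta>)
    qed
    moreover have "the (\<eta> t) = of_real (Re (the (\<eta> t)))" using t(2) by (simp add: complex_eq_iff)
    ultimately have "Re (the (\<eta> t)) \<le> 0" by (metis not_le of_real_in_cusp_domain)
    then have "M \<le> dist (the (\<eta> 0)) (the (\<eta> t))"
      using complex_Re_le_cmod[of "the (\<eta> 0) - the (\<eta> t)"] x by (simp add: dist_norm ends) (simp add: \<gamma>_def)
    with t(1) show "\<exists>t\<in>{0..1}. M \<le> dist (the (\<eta> 0)) (the (\<eta> t))" by blast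
  qed (use M in auto)
  also have "pi * ((3 * M + M) / M)\<^sup>2 = pi * 16"
    using M by (simp add: field_simps)
  finally have "ennreal (M / pi) \<le> ennreal K * (ennreal B * (ennreal K * ennreal (pi * 16)))"
    by (simp add: mult_left_mono)
  also have "\<dots> = ennreal (K * (B * (K * (pi * 16))))"
    using \<open>1 \<le> K\<close> \<open>0 < B\<close> by (simp add: ennreal_mult)
  finally have "M / pi \<le> K * (B * (K * (pi * 16)))"
    using \<open>1 \<le> K\<close> \<open>0 < B\<close> by (subst (asm) ennreal_le_iff) auto
  then show False using M(3) by (simp add: pos_divide_le_eq)
qed

theorem corollary3p3:
  shows "\<exists>f. conformal_mapping_on right_half_plane f \<and>
    jordan_domain (Some ` f ` right_half_plane) \<and>
    \<not> quasidisk (Some ` f ` right_half_plane) \<and>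
    ((\<lambda>t::real. SUP z\<in>{z. 0 < Re z \<and> Re z \<le> t}. ereal ((2 * Re z)\<^sup>2 * norm (schwarzian f z)))
       \<longlongrightarrow> 0) (at_right 0)"
proof (intro exI[of _ "\<lambda>z. Ln (1 + z)"] conjI)
  show "jordan_domain (Some ` (\<lambda>z. Ln (1 + z)) ` right_half_plane)"
    unfolding Ln_image_right_half_plane by (rule jordan_domain_cusp)
  show "\<not> quasidisk (Some ` (\<lambda>z. Ln (1 + z)) ` right_half_plane)"
    unfolding Ln_image_right_half_plane by (rule not_quasidisk_cusp)
qed (rule conformal_Ln schwarzian_Ln_limit)+

end
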